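(* Let $0 \to V \xrightarrow{} \widetilde{L} \xrightarrow{p} L \to 0$ be an abelian extension of a Lie-Yamaguti algebra $L$ by $V$, and let $\mathcal{W}$ be the associated Wells map. Then there is an exact sequence $$0\to \mathrm{H}^1(L,V)\xrightarrow{\ i\ }\mathrm{Aut}_V(\widetilde L)\xrightarrow{\ \tau\ }\mathcal{C}\xrightarrow{\ \mathcal W\ }\mathrm{H}^{(2,3)}(L,V),$$ where $i$ is the injective group homomorphism obtained from the isomorphism $\mathrm{H}^1(L,V)\cong\mathrm{Aut}^{V,L}(\widetilde L)$ followed by the inclusion $\mathrm{Aut}^{V,L}(\widetilde L)\subseteq \mathrm{Aut}_V(\widetilde L)$.
   Context: All vector spaces are over a field $\mathbb{K}$ of characteristic zero. A Lie-Yamaguti algebra is a vector space $L$ with a bilinear operation $[\cdot,\cdot]$ and a trilinear operation $\{\cdot,\cdot,\cdot\}$ such that for all $a,b,c,x,y,z$: (LY1) $[a,b]=-[b,a]$; (LY2) $\{a,b,c\}=-\{b,a,c\}$; (LY3) $[[a,b],c]+\{a,b,c\}+[[b,c],a]+\{b,c,a\}+[[c,a],b]+\{c,a,b\}=0$; (LY4) $\{[a,b],c,x\}+\{[b,c],a,x\}+\{[c,a],b,x\}=0$; (LY5) $\{a,b,[x,y]\}=[\{a,b,x\},y]+[x,\{a,b,y\}]$; (LY6) $\{a,b,\{x,y,z\}\}=\{\{a,b,x\},y,z\}+\{x,\{a,b,y\},z\}+\{x,y,\{a,b,z\}\}$. Morphisms are linear maps preserving both operations; $\mathrm{Aut}$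 denotes the group of bijective self-morphisms. An abelian extension of $L$ by $V$ is a short exact sequence $0\to V\to\widetilde L\xrightarrow{p}L\to 0$ of Lie-Yamaguti algebras such that $V$ (identified with its image) is an abelian ideal, i.e. an ideal with $[V,V]=0$ and $\{V,V,\widetilde L\}=\{V,\widetilde L,V\}=\{\widetilde L,V,V\}=0$. A section of $p$ is a linear map $s:L\to\widetilde L$ with $p\circ s=\mathrm{id}_L$; fix one. The induced representation of $L$ on $V$ (independent of $s$) is $\rho(a)(v)=[s(a),v]$, $D(a,b)(v)=\{s(a),s(b),v\}$, $\theta(a,b)(v)=\{v,s(a),s(b)\}$ (brackets in $\widetilde L$). The induced cocycle is $\alpha(a,b)=[s(a),s(b)]-s([a,b])$, $\beta(a,b,c)=\{s(a),s(b),s(c)\}-s(\{a,b,c\})$. Let $\mathrm{Aut}_V(\widetilde L)=\{\gamma\in\mathrm{Aut}(\widetilde L):\gamma(V)=V\}$ and, for such $\gamma$, $\bar\gamma=p\gamma s\in\mathrm{Aut}(L)$ and $\tau(\gamma)=(\gamma|_V,\bar\gamma)$. Let $\mathrm{Aut}^{V,L}(\widetilde L)=\{\gamma\in\mathrm{Aut}_V(\widetilde L):\gamma|_V=\mathrm{id}_V,\ \bar\gamma=\mathrm{id}_L\}$. $\mathcal C$ is the group of compatible pairs: those $(\phi,\psi)\in\mathrm{Aut}(V)\times\mathrm{Aut}(L)$ such that for all $a,b\in L$, $v\in V$: $\phi(\rho(a)(v))=\rho(\psi(a))(\phi(v))$, $\phi(D(a,b)(v))=D(\psi(a),\psi(b))(\phi(v))$,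 $\phi(\theta(a,b)(v))=\theta(\psi(a),\psi(b))(\phi(v))$. The map $\tau$ takes values in $\mathcal C$. Cohomology: a $(2,3)$-cochain is a pair $(f,g)$, $f:L^{\otimes 2}\to V$ and $g:L^{\otimes3}\to V$ linear, with $f(x,x)=0$ and $g(x,x,y)=0$. For a linear map $\lambda:L\to V$ put $\delta(\lambda)=(\delta_I\lambda,\delta_{II}\lambda)$, where $\delta_I\lambda(a,b)=\rho(a)\lambda(b)-\rho(b)\lambda(a)-\lambda([a,b])$ and $\delta_{II}\lambda(a,b,c)=\theta(b,c)\lambda(a)-\theta(a,c)\lambda(b)+D(a,b)\lambda(c)-\lambda(\{a,b,c\})$. $\mathrm H^1(L,V)$ is the additive group of linear $\lambda:L\to V$ with $\delta_I\lambda=0=\delta_{II}\lambda$; the isomorphism $\mathrm{Aut}^{V,L}(\widetilde L)\to\mathrm H^1(L,V)$ is $\gamma\mapsto\lambda_\gamma$, $\lambda_\gamma(a)=\gamma s(a)-s(a)$. $Z^{(2,3)}(L,V)$ is the space of $(2,3)$-cochains $(f,g)$ for which the following four expressions vanish identically: $\delta_I f(a,b,c,d)=-\rho(c)g(a,b,d)+\rho(d)g(a,b,c)+g(a,b,[c,d])+D(a,b)f(c,d)-f(\{a,b,c\},d)-f(c,\{a,b,d\})$; $\delta_{II}g(a,b,c,d,e)=-\theta(d,e)g(a,b,c)+\theta(c,e)g(a,b,d)+D(a,b)g(c,d,e)-D(c,d)g(a,b,e)-g(c,\{a,b,d\},e)-g(c,d,\{a,b,e\})+g(a,b,\{c,d,e\})-g(\{a,b,c\},d,e)$;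 $\delta_I^\star f(a,b,c)=-\rho(a)f(b,c)-\rho(b)f(c,a)-\rho(c)f(a,b)+f([a,b],c)+f([b,c],a)+f([c,a],b)+g(a,b,c)+g(b,c,a)+g(c,a,b)$; $\delta_{II}^\star g(a,b,c,d)=\theta(a,d)f(b,c)+\theta(b,d)f(c,a)+\theta(c,d)f(a,b)+g([a,b],c,d)+g([b,c],a,d)+g([c,a],b,d)$. $B^{(2,3)}(L,V)=\{\delta(\lambda):\lambda:L\to V\text{ linear}\}$ and $\mathrm H^{(2,3)}(L,V)=Z^{(2,3)}(L,V)/B^{(2,3)}(L,V)$. The Wells map is the map of sets (in general not a homomorphism) $\mathcal W:\mathcal C\to\mathrm H^{(2,3)}(L,V)$ sending $(\phi,\psi)$ to the class of $\big(\phi\circ\alpha\circ(\psi^{-1},\psi^{-1})-\alpha,\ \phi\circ\beta\circ(\psi^{-1},\psi^{-1},\psi^{-1})-\beta\big)$; it does not depend on $s$. Exactness at $\mathcal C$ means $\mathrm{Im}(\tau)=\{(\phi,\psi)\in\mathcal C:\mathcal W(\phi,\psi)=0\}$. *)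

theory Defs
  imports "HOL.Vector_Spaces" "HOL-Algebra.Coset"
begin

text \<open>
  Every vector space is a whole type of class \<open>ab_group_add\<close> together with an explicit scalar
  multiplication, as in \<^theory>\<open>HOL.Vector_Spaces\<close>. Linear maps out of a tensor power
  are written as curried multilinear maps.
\<close>

record ('k, 'a) ly_struct =
  smul :: "'k \<Rightarrow> 'a \<Rightarrow> 'a"
  br :: "'a \<Rightarrow> 'a \<Rightarrow> 'a"
  tr :: "'a \<Rightarrow> 'a \<Rightarrow> 'a \<Rightarrow> 'a"

definition bilinear_map ::
  "('k::field \<Rightarrow> 'a::ab_group_add \<Rightarrow> 'a) \<Rightarrow> ('k \<Rightarrow> 'b::ab_group_add \<Rightarrow> 'b)
    \<Rightarrow> ('a \<Rightarrow> 'a \<Rightarrow> 'b) \<Rightarrow> bool" where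
  "bilinear_map sa sb f \<longleftrightarrow>
     (\<forall>y. Vector_Spaces.linear sa sb (\<lambda>x. f x y)) \<and>
     (\<forall>x. Vector_Spaces.linear sa sb (\<lambda>y. f x y))"

definition trilinear_map ::
  "('k::field \<Rightarrow> 'a::ab_group_add \<Rightarrow> 'a) \<Rightarrow> ('k \<Rightarrow> 'b::ab_group_add \<Rightarrow> 'b)
    \<Rightarrow> ('a \<Rightarrow> 'a \<Rightarrow> 'a \<Rightarrow> 'b) \<Rightarrow> bool" where
  "trilinear_map sa sb g \<longleftrightarrow>
     (\<forall>y z. Vector_Spaces.linear sa sb (\<lambda>x. g x y z)) \<and>
     (\<forall>x z. Vector_Spaces.linear sa sb (\<lambda>y. g x y z)) \<and>
     (\<forall>x y. Vector_Spaces.linear sa sb (\<lambda>z. g x y z))"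

definition ly_algebra :: "('k::field_char_0, 'a::ab_group_add) ly_struct \<Rightarrow> bool" where
  "ly_algebra A \<longleftrightarrow>
     vector_space (smul A) \<and>
     bilinear_map (smul A) (smul A) (br A) \<and>
     trilinear_map (smul A) (smul A) (tr A) \<and>
     (\<forall>a b. br A a b = - br A b a) \<and>
     (\<forall>a b c. tr A a b c = - tr A b a c) \<and>
     (\<forall>a b c. br A (br A a b) c + tr A a b c + br A (br A b c) a + tr A b c a
                + br A (br A c a) b + tr A c a b = 0) \<and>
     (\<forall>a b c x. tr A (br A a b) c x + tr A (br A b c) a x + tr A (br A c a) b x = 0) \<and>
     (\<forall>a b x y. tr A a b (br A x y) = br A (tr A a b x) y + br A x (tr A a b y)) \<and>
     (\<forall>a b x y z. tr A a b (tr A x y z) =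
        tr A (tr A a b x) y z + tr A x (tr A a b y) z + tr A x y (tr A a b z))"

definition ly_hom ::
  "('k::field_char_0, 'a::ab_group_add) ly_struct \<Rightarrow> ('k, 'b::ab_group_add) ly_struct
    \<Rightarrow> ('a \<Rightarrow> 'b) \<Rightarrow> bool" where
  "ly_hom A B h \<longleftrightarrow>
     Vector_Spaces.linear (smul A) (smul B) h \<and>
     (\<forall>x y. h (br A x y) = br B (h x) (h y)) \<and>
     (\<forall>x y z. h (tr A x y z) = tr B (h x) (h y) (h z))"

definition ly_Aut :: "('k::field_char_0, 'a::ab_group_add) ly_struct \<Rightarrow> ('a \<Rightarrow> 'a) monoid" where
  "ly_Aut A = \<lparr>carrier = {h. ly_hom A A h \<and> bij h}, mult = (\<circ>), one = id\<rparr>"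

definition ly_ideal :: "('k::field_char_0, 'a::ab_group_add) ly_struct \<Rightarrow> 'a set \<Rightarrow> bool" where
  "ly_ideal A I \<longleftrightarrow>
     module.subspace (smul A) I \<and>
     (\<forall>u\<in>I. \<forall>x. br A u x \<in> I \<and> br A x u \<in> I) \<and>
     (\<forall>u\<in>I. \<forall>x y. tr A u x y \<in> I \<and> tr A x u y \<in> I \<and> tr A x y u \<in> I)"

definition ly_abelian_ideal ::
  "('k::field_char_0, 'a::ab_group_add) ly_struct \<Rightarrow> 'a set \<Rightarrow> bool" where
  "ly_abelian_ideal A I \<longleftrightarrow>
     ly_ideal A I \<and>
     (\<forall>u\<in>I. \<forall>v\<in>I. br A u v = 0) \<and>
     (\<forall>u\<in>I. \<forall>v\<in>I. \<forall>x. tr A u v x = 0 \<and> tr A u x v = 0 \<and> tr A x u v = 0)"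

text \<open>
  The extension is \<open>0 \<rightarrow> V \<rightarrow> E \<rightarrow> L \<rightarrow> 0\<close> with injection \<open>j\<close> and projection \<open>p\<close>. The
  identification of \<open>V\<close> with \<open>range j\<close> is made explicit throughout: an element of \<open>range j\<close>
  is read as an element of \<open>V\<close> by applying \<open>the_inv j\<close>.
\<close>

definition abelian_extension ::
  "('k::field_char_0, 'v::ab_group_add) ly_struct \<Rightarrow> ('k, 'e::ab_group_add) ly_struct
    \<Rightarrow> ('k, 'l::ab_group_add) ly_struct \<Rightarrow> ('v \<Rightarrow> 'e) \<Rightarrow> ('e \<Rightarrow> 'l) \<Rightarrow> bool" where
  "abelian_extension V E L j p \<longleftrightarrow>
     ly_algebra V \<and> ly_algebra E \<and> ly_algebra L \<and>
     ly_hom V E j \<and> ly_hom E L p \<and>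
     inj j \<and> range j = {x. p x = 0} \<and> surj p \<and>
     ly_abelian_ideal E (range j)"

definition is_section ::
  "('k::field_char_0, 'e::ab_group_add) ly_struct \<Rightarrow> ('k, 'l::ab_group_add) ly_struct
    \<Rightarrow> ('e \<Rightarrow> 'l) \<Rightarrow> ('l \<Rightarrow> 'e) \<Rightarrow> bool" where
  "is_section E L p s \<longleftrightarrow> Vector_Spaces.linear (smul L) (smul E) s \<and> p \<circ> s = id"

record ('l, 'v) ly_rep =
  rho :: "'l \<Rightarrow> 'v \<Rightarrow> 'v"
  repD :: "'l \<Rightarrow> 'l \<Rightarrow> 'v \<Rightarrow> 'v"
  theta :: "'l \<Rightarrow> 'l \<Rightarrow> 'v \<Rightarrow> 'v"

definition induced_rep ::
  "('k, 'e) ly_struct \<Rightarrow> ('v \<Rightarrow> 'e) \<Rightarrow> ('l \<Rightarrow> 'e) \<Rightarrow> ('l, 'v) ly_rep" where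
  "induced_rep E j s =
     \<lparr>rho = (\<lambda>a v. the_inv j (br E (s a) (j v))),
      repD = (\<lambda>a b v. the_inv j (tr E (s a) (s b) (j v))),
      theta = (\<lambda>a b v. the_inv j (tr E (j v) (s a) (s b)))\<rparr>"

definition ext_alpha ::
  "('k, 'e::ab_group_add) ly_struct \<Rightarrow> ('k, 'l) ly_struct \<Rightarrow> ('v \<Rightarrow> 'e) \<Rightarrow> ('l \<Rightarrow> 'e)
    \<Rightarrow> 'l \<Rightarrow> 'l \<Rightarrow> 'v" where
  "ext_alpha E L j s a b = the_inv j (br E (s a) (s b) - s (br L a b))"

definition ext_beta ::
  "('k, 'e::ab_group_add) ly_struct \<Rightarrow> ('k, 'l) ly_struct \<Rightarrow> ('v \<Rightarrow> 'e) \<Rightarrow> ('l \<Rightarrow> 'e)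
    \<Rightarrow> 'l \<Rightarrow> 'l \<Rightarrow> 'l \<Rightarrow> 'v" where
  "ext_beta E L j s a b c = the_inv j (tr E (s a) (s b) (s c) - s (tr L a b c))"

definition Aut_V ::
  "('k::field_char_0, 'e::ab_group_add) ly_struct \<Rightarrow> ('v \<Rightarrow> 'e) \<Rightarrow> ('e \<Rightarrow> 'e) monoid" where
  "Aut_V E j = (ly_Aut E)\<lparr>carrier := {\<gamma> \<in> carrier (ly_Aut E). \<gamma> ` range j = range j}\<rparr>"

definition aut_restrict :: "('v \<Rightarrow> 'e) \<Rightarrow> ('e \<Rightarrow> 'e) \<Rightarrow> 'v \<Rightarrow> 'v" where
  "aut_restrict j \<gamma> = (\<lambda>v. the_inv j (\<gamma> (j v)))"

definition aut_bar :: "('e \<Rightarrow> 'l) \<Rightarrow> ('l \<Rightarrow> 'e) \<Rightarrow> ('e \<Rightarrow> 'e) \<Rightarrow> 'l \<Rightarrow> 'l" where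
  "aut_bar p s \<gamma> = p \<circ> \<gamma> \<circ> s"

definition tau_map ::
  "('v \<Rightarrow> 'e) \<Rightarrow> ('e \<Rightarrow> 'l) \<Rightarrow> ('l \<Rightarrow> 'e) \<Rightarrow> ('e \<Rightarrow> 'e) \<Rightarrow> ('v \<Rightarrow> 'v) \<times> ('l \<Rightarrow> 'l)" where
  "tau_map j p s \<gamma> = (aut_restrict j \<gamma>, aut_bar p s \<gamma>)"

definition Aut_VL ::
  "('k::field_char_0, 'e::ab_group_add) ly_struct \<Rightarrow> ('v \<Rightarrow> 'e) \<Rightarrow> ('e \<Rightarrow> 'l) \<Rightarrow> ('l \<Rightarrow> 'e)
    \<Rightarrow> ('e \<Rightarrow> 'e) monoid" where
  "Aut_VL E j p s = (ly_Aut E)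
     \<lparr>carrier := {\<gamma> \<in> carrier (Aut_V E j). aut_restrict j \<gamma> = id \<and> aut_bar p s \<gamma> = id}\<rparr>"

definition compatible_pairs ::
  "('k::field_char_0, 'v::ab_group_add) ly_struct \<Rightarrow> ('k, 'l::ab_group_add) ly_struct
    \<Rightarrow> ('l, 'v) ly_rep \<Rightarrow> (('v \<Rightarrow> 'v) \<times> ('l \<Rightarrow> 'l)) monoid" where
  "compatible_pairs V L R = (ly_Aut V \<times>\<times> ly_Aut L)
     \<lparr>carrier := {(\<phi>, \<psi>). \<phi> \<in> carrier (ly_Aut V) \<and> \<psi> \<in> carrier (ly_Aut L) \<and>
        (\<forall>a v. \<phi> (rho R a v) = rho R (\<psi> a) (\<phi> v)) \<and>
        (\<forall>a b v. \<phi> (repD R a b v) = repD R (\<psi> a) (\<psi> b) (\<phi> v)) \<and>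
        (\<forall>a b v. \<phi> (theta R a b v) = theta R (\<psi> a) (\<psi> b) (\<phi> v))}\<rparr>"

type_synonym ('l, 'v) cochain23 = "('l \<Rightarrow> 'l \<Rightarrow> 'v) \<times> ('l \<Rightarrow> 'l \<Rightarrow> 'l \<Rightarrow> 'v)"

definition delta1_I ::
  "('k, 'l) ly_struct \<Rightarrow> ('l, 'v::ab_group_add) ly_rep \<Rightarrow> ('l \<Rightarrow> 'v) \<Rightarrow> 'l \<Rightarrow> 'l \<Rightarrow> 'v" where
  "delta1_I L R l a b = rho R a (l b) - rho R b (l a) - l (br L a b)"

definition delta1_II ::
  "('k, 'l) ly_struct \<Rightarrow> ('l, 'v::ab_group_add) ly_rep \<Rightarrow> ('l \<Rightarrow> 'v)
    \<Rightarrow> 'l \<Rightarrow> 'l \<Rightarrow> 'l \<Rightarrow> 'v" where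
  "delta1_II L R l a b c =
     theta R b c (l a) - theta R a c (l b) + repD R a b (l c) - l (tr L a b c)"

definition H1 ::
  "('k::field_char_0, 'v::ab_group_add) ly_struct \<Rightarrow> ('k, 'l::ab_group_add) ly_struct
    \<Rightarrow> ('l, 'v) ly_rep \<Rightarrow> ('l \<Rightarrow> 'v) monoid" where
  "H1 V L R =
     \<lparr>carrier = {l. Vector_Spaces.linear (smul L) (smul V) l \<and>
                    (\<forall>a b. delta1_I L R l a b = 0) \<and> (\<forall>a b c. delta1_II L R l a b c = 0)},
      mult = (\<lambda>l m a. l a + m a), one = (\<lambda>a. 0)\<rparr>"

definition cochains23 ::
  "('k::field_char_0, 'v::ab_group_add) ly_struct \<Rightarrow> ('k, 'l::ab_group_add) ly_struct
    \<Rightarrow> ('l, 'v) cochain23 set" where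
  "cochains23 V L = {(f, g).
     bilinear_map (smul L) (smul V) f \<and> trilinear_map (smul L) (smul V) g \<and>
     (\<forall>x. f x x = 0) \<and> (\<forall>x y. g x x y = 0)}"

definition delta_I ::
  "('k, 'l) ly_struct \<Rightarrow> ('l, 'v::ab_group_add) ly_rep \<Rightarrow> ('l, 'v) cochain23
    \<Rightarrow> 'l \<Rightarrow> 'l \<Rightarrow> 'l \<Rightarrow> 'l \<Rightarrow> 'v" where
  "delta_I L R = (\<lambda>(f, g) a b c d.
     - rho R c (g a b d) + rho R d (g a b c) + g a b (br L c d) + repD R a b (f c d)
     - f (tr L a b c) d - f c (tr L a b d))"

definition delta_II ::
  "('k, 'l) ly_struct \<Rightarrow> ('l, 'v::ab_group_add) ly_rep \<Rightarrow> ('l, 'v) cochain23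
    \<Rightarrow> 'l \<Rightarrow> 'l \<Rightarrow> 'l \<Rightarrow> 'l \<Rightarrow> 'l \<Rightarrow> 'v" where
  "delta_II L R = (\<lambda>(f, g) a b c d e.
     - theta R d e (g a b c) + theta R c e (g a b d) + repD R a b (g c d e)
     - repD R c d (g a b e) - g c (tr L a b d) e - g c d (tr L a b e)
     + g a b (tr L c d e) - g (tr L a b c) d e)"

definition delta_star_I ::
  "('k, 'l) ly_struct \<Rightarrow> ('l, 'v::ab_group_add) ly_rep \<Rightarrow> ('l, 'v) cochain23
    \<Rightarrow> 'l \<Rightarrow> 'l \<Rightarrow> 'l \<Rightarrow> 'v" where
  "delta_star_I L R = (\<lambda>(f, g) a b c.
     - rho R a (f b c) - rho R b (f c a) - rho R c (f a b)
     + f (br L a b) c + f (br L b c) a + f (br L c a) b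
     + g a b c + g b c a + g c a b)"

definition delta_star_II ::
  "('k, 'l) ly_struct \<Rightarrow> ('l, 'v::ab_group_add) ly_rep \<Rightarrow> ('l, 'v) cochain23
    \<Rightarrow> 'l \<Rightarrow> 'l \<Rightarrow> 'l \<Rightarrow> 'l \<Rightarrow> 'v" where
  "delta_star_II L R = (\<lambda>(f, g) a b c d.
     theta R a d (f b c) + theta R b d (f c a) + theta R c d (f a b)
     + g (br L a b) c d + g (br L b c) a d + g (br L c a) b d)"

definition Z23 ::
  "('k::field_char_0, 'v::ab_group_add) ly_struct \<Rightarrow> ('k, 'l::ab_group_add) ly_struct
    \<Rightarrow> ('l, 'v) ly_rep \<Rightarrow> ('l, 'v) cochain23 monoid" where
  "Z23 V L R =
     \<lparr>carrier = {w \<in> cochains23 V L.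
        (\<forall>a b c d. delta_I L R w a b c d = 0) \<and>
        (\<forall>a b c d e. delta_II L R w a b c d e = 0) \<and>
        (\<forall>a b c. delta_star_I L R w a b c = 0) \<and>
        (\<forall>a b c d. delta_star_II L R w a b c d = 0)},
      mult = (\<lambda>(f, g) (f', g'). (\<lambda>a b. f a b + f' a b, \<lambda>a b c. g a b c + g' a b c)),
      one = (\<lambda>a b. 0, \<lambda>a b c. 0)\<rparr>"

definition B23 ::
  "('k::field_char_0, 'v::ab_group_add) ly_struct \<Rightarrow> ('k, 'l::ab_group_add) ly_struct
    \<Rightarrow> ('l, 'v) ly_rep \<Rightarrow> ('l, 'v) cochain23 set" where
  "B23 V L R =
     {(delta1_I L R l, delta1_II L R l) | l. Vector_Spaces.linear (smul L) (smul V) l}"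

definition H23 ::
  "('k::field_char_0, 'v::ab_group_add) ly_struct \<Rightarrow> ('k, 'l::ab_group_add) ly_struct
    \<Rightarrow> ('l, 'v) ly_rep \<Rightarrow> ('l, 'v) cochain23 set monoid" where
  "H23 V L R = Z23 V L R Mod B23 V L R"

definition lambda_map ::
  "('v \<Rightarrow> 'e::ab_group_add) \<Rightarrow> ('l \<Rightarrow> 'e) \<Rightarrow> ('e \<Rightarrow> 'e) \<Rightarrow> 'l \<Rightarrow> 'v" where
  "lambda_map j s \<gamma> = (\<lambda>a. the_inv j (\<gamma> (s a) - s a))"

definition i_map ::
  "('k::field_char_0, 'e::ab_group_add) ly_struct \<Rightarrow> ('v \<Rightarrow> 'e) \<Rightarrow> ('e \<Rightarrow> 'l) \<Rightarrow> ('l \<Rightarrow> 'e)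
    \<Rightarrow> ('l \<Rightarrow> 'v) \<Rightarrow> 'e \<Rightarrow> 'e" where
  "i_map E j p s = inv_into (carrier (Aut_VL E j p s)) (lambda_map j s)"

definition wells_cochain ::
  "('k, 'e::ab_group_add) ly_struct \<Rightarrow> ('k, 'l) ly_struct \<Rightarrow> ('v::ab_group_add \<Rightarrow> 'e)
    \<Rightarrow> ('l \<Rightarrow> 'e) \<Rightarrow> ('v \<Rightarrow> 'v) \<times> ('l \<Rightarrow> 'l) \<Rightarrow> ('l, 'v) cochain23" where
  "wells_cochain E L j s = (\<lambda>(\<phi>, \<psi>).
     (\<lambda>a b. \<phi> (ext_alpha E L j s (the_inv \<psi> a) (the_inv \<psi> b)) - ext_alpha E L j s a b,
      \<lambda>a b c. \<phi> (ext_beta E L j s (the_inv \<psi> a) (the_inv \<psi> b) (the_inv \<psi> c))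
               - ext_beta E L j s a b c))"

definition wells_map ::
  "('k::field_char_0, 'v::ab_group_add) ly_struct \<Rightarrow> ('k, 'e::ab_group_add) ly_struct
    \<Rightarrow> ('k, 'l::ab_group_add) ly_struct \<Rightarrow> ('v \<Rightarrow> 'e) \<Rightarrow> ('l \<Rightarrow> 'e)
    \<Rightarrow> ('v \<Rightarrow> 'v) \<times> ('l \<Rightarrow> 'l) \<Rightarrow> ('l, 'v) cochain23 set" where
  "wells_map V E L j s c =
     B23 V L (induced_rep E j s) #>\<^bsub>Z23 V L (induced_rep E j s)\<^esub> wells_cochain E L j s c"

end

theory Submission
  imports Defs
begin

text \<open>
  Fix the section \<open>s\<close>. Every element of \<open>E\<close> is \<open>s a + j u\<close> for unique \<open>a\<close> and \<open>u\<close>, and in these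
  coordinates (lemmas \<open>br_emb\<close> and \<open>tr_emb\<close>) the two operations of \<open>E\<close> are given by the
  operations of \<open>L\<close>, the induced representation and the induced cocycle \<open>(\<alpha>, \<beta>)\<close>. So a pair
  \<open>(j, s)\<close>, called a frame below, carries data that determine the extension: two frames with the
  same representation and the same cocycle are exchanged by a unique isomorphism
  (\<open>equivalent_extensions\<close>), and every isomorphism that maps one frame to another preserves
  the data (\<open>induced_data_transport\<close>). The whole sequence is read off from the way in
  which these data change with the frame.

  \<^item> Replacing \<open>s\<close> by \<open>s + j \<circ> l\<close> keeps the representation and adds \<open>\<delta> l\<close> to the cocycle. Both
    cocycles satisfy the cocycle identities, hence so does \<open>\<delta> l\<close>: coboundaries are cocycles.
    An automorphism \<open>\<gamma>\<close> that induces the identity on \<open>V\<close> and on \<open>L\<close> maps the frame \<open>(j, s)\<close> to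
    \<open>(j, s + j \<circ> l)\<close> with \<open>l = lambda_map j s \<gamma>\<close>, so such automorphisms correspond to the \<open>l\<close>
    with \<open>\<delta> l = 0\<close>.
  \<^item> Replacing \<open>(j, s)\<close> by \<open>(j \<circ> \<phi>\<inverse>, s \<circ> \<psi>\<inverse>)\<close>, with projection \<open>\<psi> \<circ> p\<close>, twists the data by
    \<open>(\<phi>, \<psi>)\<close>. The representation is unchanged exactly when \<open>(\<phi>, \<psi>)\<close> is compatible, and the Wells
    cochain is the cocycle of the twisted frame minus the original one. Being a difference of two
    cocycles for the same representation, it is a cocycle.
  \<^item> For exactness at the compatible pairs, note that \<open>\<gamma>\<close> induces \<open>(\<phi>, \<psi>)\<close> exactly when it maps
    the twisted frame to \<open>(j, s + j \<circ> l)\<close> for some \<open>l\<close>. For a compatible pair such a \<open>\<gamma>\<close> exists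
    if and only if both frames have the same cocycle, that is, if and only if the Wells cochain
    equals \<open>\<delta> l\<close>.
\<close>

section \<open>Lie-Yamaguti algebras and their automorphism groups\<close>

lemma ly_vs: "ly_algebra A \<Longrightarrow> vector_space (smul A)" by (simp add: ly_algebra_def)

lemma ly_linear:
  assumes "ly_algebra A"
  shows "br A (x + x') y = br A x y + br A x' y" "br A x (y + y') = br A x y + br A x y'"
    "br A (smul A k x) y = smul A k (br A x y)" "br A x (smul A k y) = smul A k (br A x y)"
    "tr A (x + x') y z = tr A x y z + tr A x' y z" "tr A x (y + y') z = tr A x y z + tr A x y' z"
    "tr A x y (z + z') = tr A x y z + tr A x y z'"
    "tr A (smul A k x) y z = smul A k (tr A x y z)" "tr A x (smul A k y) z = smul A k (tr A x y z)"
    "tr A x y (smul A k z) = smul A k (tr A x y z)"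
    "smul A k (x + y) = smul A k x + smul A k y"
proof -
  have "vector_space (smul A)" "bilinear_map (smul A) (smul A) (br A)"
    "trilinear_map (smul A) (smul A) (tr A)"
    using assms unfolding ly_algebra_def by blast+
  then show "br A (x + x') y = br A x y + br A x' y" "br A x (y + y') = br A x y + br A x y'"
    "br A (smul A k x) y = smul A k (br A x y)" "br A x (smul A k y) = smul A k (br A x y)"
    "tr A (x + x') y z = tr A x y z + tr A x' y z" "tr A x (y + y') z = tr A x y z + tr A x y' z"
    "tr A x y (z + z') = tr A x y z + tr A x y z'"
    "tr A (smul A k x) y z = smul A k (tr A x y z)" "tr A x (smul A k y) z = smul A k (tr A x y z)"
    "tr A x y (smul A k z) = smul A k (tr A x y z)"
    "smul A k (x + y) = smul A k x + smul A k y"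
    by (simp_all add: bilinear_map_def trilinear_map_def Vector_Spaces.linear_iff
        vector_space_def)
qed

lemma ly_laws:
  assumes "ly_algebra A"
  shows ly_skew_br: "br A a b = - br A b a"
    and ly_skew_tr: "tr A a b c = - tr A b a c"
    and ly_law3: "br A (br A a b) c + tr A a b c + br A (br A b c) a + tr A b c a
                + br A (br A c a) b + tr A c a b = 0"
    and ly_law4: "tr A (br A a b) c x + tr A (br A b c) a x + tr A (br A c a) b x = 0"
    and ly_law5: "tr A a b (br A x y) = br A (tr A a b x) y + br A x (tr A a b y)"
    and ly_law6: "tr A a b (tr A x y z) =
        tr A (tr A a b x) y z + tr A x (tr A a b y) z + tr A x y (tr A a b z)"
  using assms[unfolded ly_algebra_def] by metis+

lemma ly_alternating:
  fixes A :: "('a::field_char_0, 'b::ab_group_add) ly_struct"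
  assumes A: "ly_algebra A"
  shows "br A x x = 0" "tr A x x y = 0"
proof -
  interpret vector_space "smul A" using A by (rule ly_vs)
  have zero: "a = 0" if "a = - a" for a :: 'b
  proof -
    \<comment> \<open>Skew-symmetry implies alternation because the characteristic is not 2.\<close>
    have "smul A 2 a = a + a"
      using scale_left_distrib[of 1 1 a] by simp
    then have "smul A 2 a = 0"
      using that by (metis add.right_inverse)
    then show "a = 0" by simp
  qed
  show "br A x x = 0" "tr A x x y = 0"
    by (rule zero, rule ly_skew_br[OF A] ly_skew_tr[OF A])+
qed

lemma ly_hom_compose: "ly_hom A B f \<Longrightarrow> ly_hom B C g \<Longrightarrow> ly_hom A C (g \<circ> f)"
  by (auto simp: ly_hom_def intro: Vector_Spaces.linear_compose)

lemma ly_hom_the_inv: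
  assumes h: "ly_hom A B h" and "bij h"
  shows "ly_hom B A (the_inv h)"
proof -
  have inj: "inj h" and hi: "h (the_inv h y) = y" for y
    using \<open>bij h\<close> by (auto simp: bij_is_inj bij_is_surj f_the_inv_into_f)
  interpret h: Vector_Spaces.linear "smul A" "smul B" h
    using h by (simp add: ly_hom_def)
  show ?thesis
    unfolding ly_hom_def Vector_Spaces.linear_iff
    using h
    by (intro conjI allI h.vs1.vector_space_axioms h.vs2.vector_space_axioms; intro injD[OF inj])
      (simp_all add: h.add h.scale hi ly_hom_def)
qed

lemma bij_the_inv: "bij h \<Longrightarrow> bij (the_inv h)"
  using bij_betw_the_inv_into by blast

lemma bij_inverse:
  assumes "bij h"
  shows "h (the_inv h y) = y" "the_inv h (h x) = x" "the_inv h \<circ> h = id"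
  using assms
  by (auto simp: bij_is_inj bij_is_surj f_the_inv_into_f the_inv_f_f fun_eq_iff)

lemma group_ly_Aut:
  assumes A: "ly_algebra A"
  shows "group (ly_Aut A)"
proof (rule groupI)
  show "\<one>\<^bsub>ly_Aut A\<^esub> \<in> carrier (ly_Aut A)"
    using vector_space.linear_id[OF ly_vs[OF A]]
    by (simp add: ly_Aut_def ly_hom_def id_def) (simp add: bij_def)
next
  fix h assume "h \<in> carrier (ly_Aut A)"
  then show "\<exists>g\<in>carrier (ly_Aut A). g \<otimes>\<^bsub>ly_Aut A\<^esub> h = \<one>\<^bsub>ly_Aut A\<^esub>"
    by (intro bexI[of _ "the_inv h"])
      (auto simp: ly_Aut_def ly_hom_the_inv bij_the_inv bij_inverse)
qed (auto simp: ly_Aut_def ly_hom_compose bij_comp o_assoc)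

lemma inv_ly_Aut:
  assumes "ly_algebra A" "h \<in> carrier (ly_Aut A)"
  shows "inv\<^bsub>ly_Aut A\<^esub> h = the_inv h"
  using assms
  by (intro group.inv_equality group_ly_Aut)
    (auto simp: ly_Aut_def ly_hom_the_inv bij_the_inv bij_inverse)

section \<open>Cocycles and coboundaries of a linear representation\<close>

text \<open>
  The setting in which cocycles form a group and \<open>\<delta>\<close> is additive: both are consequences of the
  linearity of the three families of operators.
\<close>

locale linear_rep =
  fixes V :: "('k::field_char_0, 'v::ab_group_add) ly_struct"
    and L :: "('k, 'l::ab_group_add) ly_struct"
    and R :: "('l, 'v) ly_rep"
  assumes vsV: "vector_space (smul V)"
    and vsL: "vector_space (smul L)"
    and linear_rho: "Vector_Spaces.linear (smul V) (smul V) (rho R a)"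
    and linear_D: "Vector_Spaces.linear (smul V) (smul V) (repD R a b)"
    and linear_theta: "Vector_Spaces.linear (smul V) (smul V) (theta R a b)"
begin

interpretation V: vector_space "smul V" by (rule vsV)
interpretation rho: Vector_Spaces.linear "smul V" "smul V" "rho R a" for a by (rule linear_rho)
interpretation D: Vector_Spaces.linear "smul V" "smul V" "repD R a b" for a b by (rule linear_D)
interpretation theta: Vector_Spaces.linear "smul V" "smul V" "theta R a b" for a b
  by (rule linear_theta)

lemmas rep_zero = rho.zero D.zero theta.zero
lemmas rep_additive = rho.add D.add theta.add rho.neg D.neg theta.neg rho.diff D.diff theta.diff

lemma cochains23_closed:
  assumes "(f, g) \<in> cochains23 V L" "(f', g') \<in> cochains23 V L"
  shows "(\<lambda>a b. f a b - f' a b, \<lambda>a b c. g a b c - g' a b c) \<in> cochains23 V L"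
  using assms
  by (auto simp: cochains23_def bilinear_map_def trilinear_map_def Vector_Spaces.linear_iff
      V.scale_right_diff_distrib)

text \<open>
  All four coboundary expressions are additive in the cochain. Closure is proved for differences
  because both the coboundaries \<open>\<delta> l\<close> and the Wells cochains arise as differences of two cocycles;
  closure under negation and sum then follows.
\<close>

lemma Z23_diff:
  assumes "(f, g) \<in> carrier (Z23 V L R)" "(f', g') \<in> carrier (Z23 V L R)"
  shows "(\<lambda>a b. f a b - f' a b, \<lambda>a b c. g a b c - g' a b c) \<in> carrier (Z23 V L R)"
proof -
  let ?w = "(\<lambda>a b. f a b - f' a b, \<lambda>a b c. g a b c - g' a b c)"
  have "delta_I L R ?w a b c d = delta_I L R (f, g) a b c d - delta_I L R (f', g') a b c d"
    "delta_II L R ?w a b c d e = delta_II L R (f, g) a b c d e - delta_II L R (f', g') a b c d e"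
    "delta_star_I L R ?w a b c = delta_star_I L R (f, g) a b c - delta_star_I L R (f', g') a b c"
    "delta_star_II L R ?w a b c d
      = delta_star_II L R (f, g) a b c d - delta_star_II L R (f', g') a b c d" for a b c d e
    unfolding delta_I_def delta_II_def delta_star_I_def delta_star_II_def prod.case
    by (simp_all only: rep_additive diff_conv_add_uminus minus_add_distrib minus_minus add_ac)
  then show ?thesis
    using assms cochains23_closed[of f g f' g'] by (simp add: Z23_def)
qed

lemma Z23_zero: "(\<lambda>a b. 0, \<lambda>a b c. 0) \<in> carrier (Z23 V L R)"
  by (simp add: Z23_def cochains23_def bilinear_map_def trilinear_map_def
      Vector_Spaces.linear_iff vsV vsL delta_I_def delta_II_def delta_star_I_def
      delta_star_II_def rep_zero)

lemma Z23_uminus: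
  assumes "(f, g) \<in> carrier (Z23 V L R)"
  shows "(\<lambda>a b. - f a b, \<lambda>a b c. - g a b c) \<in> carrier (Z23 V L R)"
  using Z23_diff[OF Z23_zero assms] by simp

lemma Z23_add:
  assumes "(f, g) \<in> carrier (Z23 V L R)" "(f', g') \<in> carrier (Z23 V L R)"
  shows "(\<lambda>a b. f a b + f' a b, \<lambda>a b c. g a b c + g' a b c) \<in> carrier (Z23 V L R)"
  using Z23_diff[OF assms(1) Z23_uminus[OF assms(2)]] by simp

lemma comm_group_Z23: "comm_group (Z23 V L R)"
proof (rule comm_groupI)
  fix x assume x: "x \<in> carrier (Z23 V L R)"
  obtain f g where fg: "x = (f, g)" by (cases x)
  show "\<exists>y\<in>carrier (Z23 V L R). y \<otimes>\<^bsub>Z23 V L R\<^esub> x = \<one>\<^bsub>Z23 V L R\<^esub>"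
    using Z23_uminus[of f g] x unfolding fg
    by (intro bexI[of _ "(\<lambda>a b. - f a b, \<lambda>a b c. - g a b c)"]) (simp_all add: Z23_def)
next
  fix x y assume "x \<in> carrier (Z23 V L R)" "y \<in> carrier (Z23 V L R)"
  then show "x \<otimes>\<^bsub>Z23 V L R\<^esub> y \<in> carrier (Z23 V L R)"
    by (cases x; cases y) (use Z23_add in \<open>simp add: Z23_def\<close>)
next
  show "\<one>\<^bsub>Z23 V L R\<^esub> \<in> carrier (Z23 V L R)"
    using Z23_zero by (simp add: Z23_def)
qed (auto simp: Z23_def algebra_simps split: prod.splits)

lemma delta1_add:
  "delta1_I L R (\<lambda>a. l a + m a) a b = delta1_I L R l a b + delta1_I L R m a b"
  "delta1_II L R (\<lambda>a. l a + m a) a b c = delta1_II L R l a b c + delta1_II L R m a b c"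
  by (simp_all add: delta1_I_def delta1_II_def rep_additive)

lemma delta1_uminus:
  "delta1_I L R (\<lambda>a. - l a) a b = - delta1_I L R l a b"
  "delta1_II L R (\<lambda>a. - l a) a b c = - delta1_II L R l a b c"
  by (simp_all add: delta1_I_def delta1_II_def rep_additive)

interpretation pair: vector_space_pair "smul L" "smul V"
  by (intro vector_space_pair.intro vsL vsV)

lemma H1_closed:
  assumes "l \<in> carrier (H1 V L R)" "m \<in> carrier (H1 V L R)"
  shows "(\<lambda>a. l a + m a) \<in> carrier (H1 V L R)" "(\<lambda>a. - l a) \<in> carrier (H1 V L R)"
  using assms pair.linear_compose_add[of l m] pair.linear_compose_neg[of l]
  unfolding H1_def
  by (simp_all only: partial_object.simps mem_Collect_eq delta1_add delta1_uminus) simp_all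

lemma group_H1: "group (H1 V L R)"
proof (rule groupI)
  fix l assume l: "l \<in> carrier (H1 V L R)"
  then show "\<exists>m\<in>carrier (H1 V L R). m \<otimes>\<^bsub>H1 V L R\<^esub> l = \<one>\<^bsub>H1 V L R\<^esub>"
    using H1_closed(2)[OF l l] by (intro bexI[of _ "\<lambda>a. - l a"]) (simp_all add: H1_def)
next
  fix l m assume "l \<in> carrier (H1 V L R)" "m \<in> carrier (H1 V L R)"
  then show "l \<otimes>\<^bsub>H1 V L R\<^esub> m \<in> carrier (H1 V L R)"
    using H1_closed(1)[of l m] by (simp add: H1_def)
next
  show "\<one>\<^bsub>H1 V L R\<^esub> \<in> carrier (H1 V L R)"
    by (simp add: H1_def pair.linear_zero delta1_I_def delta1_II_def rep_zero)
qed (simp_all add: H1_def add.assoc)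

text \<open>
  That coboundaries are cocycles uses the representation axioms; it is a hypothesis here and is
  derived for induced representations from a change of section in \<open>coboundary_is_cocycle\<close>.
\<close>

lemma subgroup_B23:
  assumes "B23 V L R \<subseteq> carrier (Z23 V L R)"
  shows "subgroup (B23 V L R) (Z23 V L R)"
proof -
  interpret comm_group "Z23 V L R" by (rule comm_group_Z23)
  show ?thesis
  proof (rule subgroupI)
    have "(delta1_I L R (\<lambda>a. 0), delta1_II L R (\<lambda>a. 0)) \<in> B23 V L R"
      unfolding B23_def using pair.linear_zero by blast
    then show "B23 V L R \<noteq> {}" by blast
  next
    fix w assume w: "w \<in> B23 V L R"
    then obtain l where l: "Vector_Spaces.linear (smul L) (smul V) l"
      "w = (delta1_I L R l, delta1_II L R l)"
      by (auto simp: B23_def)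
    define w' where "w' = (delta1_I L R (\<lambda>a. - l a), delta1_II L R (\<lambda>a. - l a))"
    have w': "w' \<in> B23 V L R"
      unfolding B23_def w'_def using pair.linear_compose_neg[OF l(1)] by blast
    have "w' \<otimes>\<^bsub>Z23 V L R\<^esub> w = \<one>\<^bsub>Z23 V L R\<^esub>"
      by (simp add: w'_def l(2) Z23_def delta1_uminus)
    then have "inv\<^bsub>Z23 V L R\<^esub> w = w'"
      using w w' assms by (intro inv_equality) auto
    then show "inv\<^bsub>Z23 V L R\<^esub> w \<in> B23 V L R" using w' by simp
  next
    fix w w' assume "w \<in> B23 V L R" "w' \<in> B23 V L R"
    then obtain l m where l: "Vector_Spaces.linear (smul L) (smul V) l"
      "w = (delta1_I L R l, delta1_II L R l)"
      and m: "Vector_Spaces.linear (smul L) (smul V) m"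
      "w' = (delta1_I L R m, delta1_II L R m)"
      by (auto simp: B23_def)
    have "w \<otimes>\<^bsub>Z23 V L R\<^esub> w'
        = (delta1_I L R (\<lambda>a. l a + m a), delta1_II L R (\<lambda>a. l a + m a))"
      by (simp add: l(2) m(2) Z23_def delta1_add fun_eq_iff)
    then show "w \<otimes>\<^bsub>Z23 V L R\<^esub> w' \<in> B23 V L R"
      unfolding B23_def using pair.linear_compose_add[OF l(1) m(1)] by blast
  qed (rule assms)
qed

end

section \<open>Coordinates on an abelian extension\<close>

text \<open>
  The injection, the projection and the section are all parameters: one algebra \<open>E\<close> is viewed as
  an extension in several ways, and the results are interpreted once for each way.
\<close>

locale framed_extension =
  fixes V :: "('k::field_char_0, 'v::ab_group_add) ly_struct"
    and E :: "('k, 'e::ab_group_add) ly_struct"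
    and L :: "('k, 'l::ab_group_add) ly_struct"
    and j :: "'v \<Rightarrow> 'e" and p :: "'e \<Rightarrow> 'l" and s :: "'l \<Rightarrow> 'e"
  assumes ext: "abelian_extension V E L j p"
    and sec: "is_section E L p s"
begin

abbreviation "R \<equiv> induced_rep E j s"
abbreviation "\<rho> \<equiv> rho R"
abbreviation "D \<equiv> repD R"
abbreviation "\<theta> \<equiv> theta R"
abbreviation "\<alpha> \<equiv> ext_alpha E L j s"
abbreviation "\<beta> \<equiv> ext_beta E L j s"

text \<open>
  The linear isomorphism from the direct sum of \<open>L\<close> and \<open>V\<close> to \<open>E\<close> given by the section.
\<close>

definition emb :: "'l \<Rightarrow> 'v \<Rightarrow> 'e" where
  "emb a u = s a + j u"

lemma lyV: "ly_algebra V" and lyE: "ly_algebra E" and lyL: "ly_algebra L"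
  and homj: "ly_hom V E j" and homp: "ly_hom E L p"
  and injj: "inj j" and rangej: "range j = {x. p x = 0}"
  and abelian: "ly_abelian_ideal E (range j)"
  and lin_s: "Vector_Spaces.linear (smul L) (smul E) s"
  and p_s: "p (s a) = a"
  using ext sec by (auto simp: abelian_extension_def is_section_def fun_eq_iff)

lemma lin_j: "Vector_Spaces.linear (smul V) (smul E) j"
  and lin_p: "Vector_Spaces.linear (smul E) (smul L) p"
  using homj homp by (auto simp: ly_hom_def)

interpretation j: Vector_Spaces.linear "smul V" "smul E" j by (rule lin_j)
interpretation p: Vector_Spaces.linear "smul E" "smul L" p by (rule lin_p)
interpretation s: Vector_Spaces.linear "smul L" "smul E" s by (rule lin_s)

lemma p_j: "p (j u) = 0"
  using rangej by blast

lemma j_the_inv: "p x = 0 \<Longrightarrow> j (the_inv j x) = x"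
  using rangej by (metis (mono_tags) f_the_inv_into_f injj mem_Collect_eq)

lemma the_inv_j: "the_inv j (j u) = u"
  using injj by (rule the_inv_f_f)

lemma emb_add: "emb a u + emb b v = emb (a + b) (u + v)"
  and emb_scale: "smul E k (emb a u) = emb (smul L k a) (smul V k u)"
  and emb_zero: "emb 0 0 = 0"
  and p_emb: "p (emb a u) = a"
  and s_eq_emb: "s a = emb a 0"
  and j_eq_emb: "j u = emb 0 u"
  by (simp_all add: emb_def s.add j.add s.scale j.scale p.add p_s p_j
      ly_linear[OF lyE])

lemma emb_diff: "emb a u - emb b v = emb (a - b) (u - v)"
  by (simp add: emb_def s.diff j.diff)

lemma emb_eq_iff: "emb a u = emb b v \<longleftrightarrow> a = b \<and> u = v"
  using p_emb[of a u] p_emb[of b v] injj by (auto simp: emb_def inj_eq)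

lemma emb_eq_0_iff: "emb a u = 0 \<longleftrightarrow> a = 0 \<and> u = 0"
  using emb_eq_iff[of a u 0 0] by (simp add: emb_zero)

lemma ker_p: "p x = 0 \<Longrightarrow> \<exists>u. x = j u"
  using rangej by (metis (mono_tags) mem_Collect_eq rangeE)

lemma emb_cases: obtains a u where "e = emb a u"
proof -
  have "p (e - s (p e)) = 0" by (simp add: p.diff p_s)
  then obtain u where "e - s (p e) = j u" using ker_p by blast
  then have "e = emb (p e) u" by (simp add: emb_def algebra_simps)
  then show thesis ..
qed

lemma j_rho: "j (\<rho> a v) = br E (s a) (j v)"
  and j_D: "j (D a b v) = tr E (s a) (s b) (j v)"
  and j_theta: "j (\<theta> a b v) = tr E (j v) (s a) (s b)"
proof -
  have "br E (s a) (j v) \<in> range j" "tr E (s a) (s b) (j v) \<in> range j"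
    "tr E (j v) (s a) (s b) \<in> range j"
    using abelian unfolding ly_abelian_ideal_def ly_ideal_def by blast+
  then show "j (\<rho> a v) = br E (s a) (j v)" "j (D a b v) = tr E (s a) (s b) (j v)"
    "j (\<theta> a b v) = tr E (j v) (s a) (s b)"
    by (simp_all add: induced_rep_def f_the_inv_into_f[OF injj])
qed

lemma j_alpha: "j (\<alpha> a b) = br E (s a) (s b) - s (br L a b)"
  and j_beta: "j (\<beta> a b c) = tr E (s a) (s b) (s c) - s (tr L a b c)"
  using homp unfolding ext_alpha_def ext_beta_def
  by (auto intro!: j_the_inv simp: p.diff p_s ly_hom_def)

text \<open>
  The structure equations. Terms with two entries from \<open>V\<close> vanish since \<open>V\<close> is an abelian ideal;
  the minus signs come from the skew-symmetries that bring \<open>[j u, s b]\<close> and \<open>{s a, j v, s c}\<close> to the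
  form used in the definitions of \<open>\<rho>\<close> and \<open>\<theta>\<close>.
\<close>

lemma br_emb: "br E (emb a u) (emb b v) = emb (br L a b) (\<alpha> a b + \<rho> a v - \<rho> b u)"
proof -
  have "br E (j u) (j v) = 0"
    using abelian unfolding ly_abelian_ideal_def by blast
  moreover have "br E (j u) (s b) = - j (\<rho> b u)"
    using ly_skew_br[OF lyE, of "j u" "s b"] by (simp add: j_rho)
  ultimately show ?thesis
    by (simp add: emb_def ly_linear[OF lyE] j.add j.diff j_alpha j_rho algebra_simps)
qed

lemma tr_emb: "tr E (emb a u) (emb b v) (emb c w) =
    emb (tr L a b c) (\<beta> a b c + \<theta> b c u - \<theta> a c v + D a b w)"
proof -
  have "tr E (j u) (j v) x = 0" "tr E (j u) x (j w) = 0" "tr E x (j v) (j w) = 0" for x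
    using abelian unfolding ly_abelian_ideal_def by blast+
  moreover have "tr E (s a) (j v) (s c) = - j (\<theta> a c v)"
    using ly_skew_tr[OF lyE, of "s a" "j v" "s c"] by (simp add: j_theta)
  ultimately show ?thesis
    by (simp add: emb_def ly_linear[OF lyE] j.add j.diff j_beta j_theta j_D algebra_simps)
qed

lemma rep_linear:
  "Vector_Spaces.linear (smul V) (smul V) (\<rho> a)"
  "Vector_Spaces.linear (smul V) (smul V) (D a b)"
  "Vector_Spaces.linear (smul V) (smul V) (\<theta> a b)"
  unfolding Vector_Spaces.linear_iff
  by (auto simp: inj_eq[OF injj, symmetric] ly_vs lyV j.add j.scale j_rho j_D j_theta
      ly_linear[OF lyE])

lemma bilinear_alpha: "bilinear_map (smul L) (smul V) \<alpha>"
  unfolding bilinear_map_def Vector_Spaces.linear_iff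
  by (intro conjI allI ly_vs[OF lyV] ly_vs[OF lyL]; rule injD[OF injj])
    (simp_all add: j.add j.scale j_alpha s.add s.scale
      ly_linear[OF lyE] ly_linear[OF lyL] j.vs2.scale_right_diff_distrib)

lemma trilinear_beta: "trilinear_map (smul L) (smul V) \<beta>"
  unfolding trilinear_map_def Vector_Spaces.linear_iff
  by (intro conjI allI ly_vs[OF lyV] ly_vs[OF lyL]; rule injD[OF injj])
    (simp_all add: j.add j.scale j_beta s.add s.scale
      ly_linear[OF lyE] ly_linear[OF lyL] j.vs2.scale_right_diff_distrib)

sublocale linear_rep V L R
  by (intro linear_rep.intro rep_linear ly_vs[OF lyV] ly_vs[OF lyL])

text \<open>
  Each cocycle identity is the \<open>V\<close>-coordinate of one of the axioms (LY3)-(LY6) of \<open>E\<close>, evaluated at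
  elements of the section.
\<close>

lemma cocycle: "(\<alpha>, \<beta>) \<in> carrier (Z23 V L R)"
proof -
  have "(\<alpha>, \<beta>) \<in> cochains23 V L"
  proof -
    have "\<alpha> a a = 0" "\<beta> a a b = 0" for a b
      using j_alpha[of a a] j_beta[of a a b] injD[OF injj, of _ 0]
      by (auto simp: ly_alternating[OF lyE] ly_alternating[OF lyL])
    then show ?thesis
      using bilinear_alpha trilinear_beta by (simp add: cochains23_def)
  qed
  moreover have "delta_star_I L R (\<alpha>, \<beta>) a b c = 0" for a b c
    by (rule trans[OF _ ly_law3[OF lyE, of "emb a 0" "emb b 0" "emb c 0",
        unfolded br_emb tr_emb emb_add emb_eq_0_iff, THEN conjunct2]])
      (simp add: rep_zero delta_star_I_def algebra_simps)
  moreover have "delta_star_II L R (\<alpha>, \<beta>) a b c d = 0" for a b c d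
    by (rule trans[OF _ ly_law4[OF lyE, of "emb a 0" "emb b 0" "emb c 0" "emb d 0",
        unfolded br_emb tr_emb emb_add emb_eq_0_iff, THEN conjunct2]])
      (simp add: rep_zero delta_star_II_def algebra_simps)
  moreover have "delta_I L R (\<alpha>, \<beta>) a b c d = 0" for a b c d
    by (rule trans[OF _ ly_law5[OF lyE, of "emb a 0" "emb b 0" "emb c 0" "emb d 0",
        unfolded br_emb tr_emb emb_add emb_eq_iff, THEN conjunct2, THEN eq_iff_diff_eq_0[THEN iffD1]]])
      (simp add: rep_zero delta_I_def algebra_simps)
  moreover have "delta_II L R (\<alpha>, \<beta>) a b c d e = 0" for a b c d e
    by (rule trans[OF _ ly_law6[OF lyE, of "emb a 0" "emb b 0" "emb c 0" "emb d 0" "emb e 0",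
        unfolded br_emb tr_emb emb_add emb_eq_iff, THEN conjunct2, THEN eq_iff_diff_eq_0[THEN iffD1]]])
      (simp add: rep_zero delta_II_def algebra_simps)
  ultimately show ?thesis by (simp add: Z23_def)
qed

section \<open>Changing the section\<close>

text \<open>
  The representation can be computed from any lifts of the elements of \<open>L\<close>, because the
  \<open>V\<close>-coordinates of the lifts act trivially on \<open>V\<close>. This is its independence of the section.
\<close>

lemma op_emb_j:
  "br E (emb a u) (j v) = j (\<rho> a v)"
  "tr E (emb a u) (emb b v) (j w) = j (D a b w)"
  "tr E (j w) (emb a u) (emb b v) = j (\<theta> a b w)"
proof -
  have "br E (j u) (j v) = 0" "tr E (j u) (j v) x = 0" "tr E (j u) x (j w) = 0"
    "tr E x (j v) (j w) = 0" for u v w x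
    using abelian unfolding ly_abelian_ideal_def by blast+
  then show "br E (emb a u) (j v) = j (\<rho> a v)"
    "tr E (emb a u) (emb b v) (j w) = j (D a b w)"
    "tr E (j w) (emb a u) (emb b v) = j (\<theta> a b w)"
    by (simp_all add: emb_def ly_linear[OF lyE] j_rho j_D j_theta)
qed

context
  fixes l :: "'l \<Rightarrow> 'v"
  assumes l: "Vector_Spaces.linear (smul L) (smul V) l"
begin

lemma change_section_framed: "framed_extension V E L j p (\<lambda>a. emb a (l a))"
proof
  show "is_section E L p (\<lambda>a. emb a (l a))"
    using l lin_s lin_j
    by (auto simp: is_section_def fun_eq_iff p_emb Vector_Spaces.linear_iff emb_add emb_scale)
qed (rule ext)

lemma change_section_rep: "induced_rep E j (\<lambda>a. emb a (l a)) = R"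
  by (simp add: induced_rep_def[of E j "\<lambda>a. emb a (l a)"] op_emb_j the_inv_j)

lemma change_section_alpha:
  "ext_alpha E L j (\<lambda>a. emb a (l a)) a b = \<alpha> a b + delta1_I L R l a b"
  by (simp add: ext_alpha_def[of E L j "\<lambda>a. emb a (l a)"] br_emb emb_diff j_eq_emb[symmetric]
      the_inv_j delta1_I_def algebra_simps)

lemma change_section_beta:
  "ext_beta E L j (\<lambda>a. emb a (l a)) a b c = \<beta> a b c + delta1_II L R l a b c"
  by (simp add: ext_beta_def[of E L j "\<lambda>a. emb a (l a)"] tr_emb emb_diff j_eq_emb[symmetric]
      the_inv_j delta1_II_def algebra_simps)

text \<open>
  The cocycles of the sections \<open>s\<close> and \<open>s + j \<circ> l\<close> belong to the same representation and differ by
  \<open>\<delta> l\<close>.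
\<close>

lemma coboundary_is_cocycle: "(delta1_I L R l, delta1_II L R l) \<in> carrier (Z23 V L R)"
proof -
  interpret new: framed_extension V E L j p "\<lambda>a. emb a (l a)"
    by (rule change_section_framed)
  from Z23_diff[OF new.cocycle[unfolded change_section_rep] cocycle]
  show ?thesis by (simp add: change_section_alpha change_section_beta)
qed

end

lemma B23_normal: "B23 V L R \<lhd> Z23 V L R"
proof -
  have "B23 V L R \<subseteq> carrier (Z23 V L R)"
    using coboundary_is_cocycle by (auto simp: B23_def)
  then show ?thesis
    using comm_group.subgroup_imp_normal[OF comm_group_Z23] subgroup_B23 by blast
qed

end

section \<open>Isomorphisms of framed extensions\<close>

text \<open>
  In coordinates the isomorphism is the identity. It is a morphism because the structure equations
  of both extensions have the same coefficients.
\<close>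

proposition equivalent_extensions:
  assumes "framed_extension V E L j p s" "framed_extension V E' L j' p' s'"
    and rep: "induced_rep E j s = induced_rep E' j' s'"
    and alpha: "ext_alpha E L j s = ext_alpha E' L j' s'"
    and beta: "ext_beta E L j s = ext_beta E' L j' s'"
  obtains h where "ly_hom E E' h" "bij h" "\<And>v. h (j v) = j' v" "\<And>a. h (s a) = s' a"
proof -
  interpret X: framed_extension V E L j p s by fact
  interpret Y: framed_extension V E' L j' p' s' by fact
  \<comment> \<open>\<open>the_inv j (e - s (p e))\<close> is the \<open>V\<close>-coordinate of \<open>e\<close>.\<close>
  define h where "h e = Y.emb (p e) (the_inv j (e - s (p e)))" for e
  have h_emb: "h (X.emb a u) = Y.emb a u" for a u
    unfolding h_def X.p_emb by (simp add: X.emb_def X.the_inv_j)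
  have "h (e + f) = h e + h f" for e f
    by (rule X.emb_cases[of e]; rule X.emb_cases[of f]) (simp add: X.emb_add Y.emb_add h_emb)
  moreover have "h (smul E k e) = smul E' k (h e)" for k e
    by (rule X.emb_cases[of e]) (simp add: X.emb_scale Y.emb_scale h_emb)
  moreover have "h (br E e f) = br E' (h e) (h f)" for e f
    by (rule X.emb_cases[of e]; rule X.emb_cases[of f])
      (simp add: X.br_emb Y.br_emb h_emb rep alpha)
  moreover have "h (tr E e f g) = tr E' (h e) (h f) (h g)" for e f g
    by (rule X.emb_cases[of e]; rule X.emb_cases[of f]; rule X.emb_cases[of g])
      (simp add: X.tr_emb Y.tr_emb h_emb rep beta)
  ultimately have "ly_hom E E' h"
    by (simp add: ly_hom_def Vector_Spaces.linear_iff ly_vs[OF X.lyE] ly_vs[OF Y.lyE])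
  moreover have "bij h"
  proof (rule bijI)
    show "inj h"
    proof (rule injI)
      fix e f assume "h e = h f"
      then show "e = f"
        by (cases rule: X.emb_cases[of e]; cases rule: X.emb_cases[of f])
          (simp add: h_emb Y.emb_eq_iff)
    qed
    show "surj h"
    proof (rule surjI)
      fix e
      show "h (X.emb (p' e) (the_inv j' (e - s' (p' e)))) = e"
        unfolding h_emb
        by (rule Y.emb_cases[of e])
          (simp only: Y.p_emb, simp add: Y.emb_def Y.the_inv_j)
    qed
  qed
  moreover have "h (j v) = j' v" "h (s a) = s' a" for v a
    by (simp_all add: X.j_eq_emb Y.j_eq_emb X.s_eq_emb Y.s_eq_emb h_emb)
  ultimately show thesis by (rule that)
qed

text \<open>
  The representation and the cocycle are defined from the frame by the operations of the extension
  alone, and these commute with morphisms.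
\<close>

proposition induced_data_transport:
  assumes "framed_extension V E L j p s" "framed_extension V E' L j' p' s'"
    and h: "ly_hom E E' h" and hj: "\<And>v. h (j v) = j' v" and hs: "\<And>a. h (s a) = s' a"
  shows "induced_rep E' j' s' = induced_rep E j s"
    and "ext_alpha E' L j' s' = ext_alpha E L j s"
    and "ext_beta E' L j' s' = ext_beta E L j s"
proof -
  interpret X: framed_extension V E L j p s by fact
  interpret Y: framed_extension V E' L j' p' s' by fact
  interpret h: Vector_Spaces.linear "smul E" "smul E'" h
    using h by (simp add: ly_hom_def)
  have h_br: "br E' (h x) (h y) = h (br E x y)"
    and h_tr: "tr E' (h x) (h y) (h z) = h (tr E x y z)" for x y z
    using h by (simp_all add: ly_hom_def)
  have diff: "h x - h y = h (x - y)" for x y by (simp add: h.diff)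
  have "Y.\<rho> a v = X.\<rho> a v" "Y.D a b v = X.D a b v" "Y.\<theta> a b v = X.\<theta> a b v" for a b v
    by (rule injD[OF Y.injj],
      simp only: Y.j_rho Y.j_D Y.j_theta,
      simp only: hs[symmetric] hj[symmetric] h_br h_tr X.j_rho X.j_D X.j_theta)+
  then show "induced_rep E' j' s' = induced_rep E j s"
    by (intro ly_rep.equality ext) simp_all
  show "ext_alpha E' L j' s' = ext_alpha E L j s"
    by (intro HOL.ext injD[OF Y.injj], simp only: Y.j_alpha)
      (simp only: hs[symmetric] hj[symmetric] h_br diff X.j_alpha)
  show "ext_beta E' L j' s' = ext_beta E L j s"
    by (intro HOL.ext injD[OF Y.injj], simp only: Y.j_beta)
      (simp only: hs[symmetric] hj[symmetric] h_tr diff X.j_beta)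
qed

section \<open>Twisting by a pair of automorphisms\<close>

context framed_extension
begin

context
  fixes \<phi> :: "'v \<Rightarrow> 'v" and \<psi> :: "'l \<Rightarrow> 'l"
  assumes phi: "\<phi> \<in> carrier (ly_Aut V)" and psi: "\<psi> \<in> carrier (ly_Aut L)"
begin

abbreviation "j' \<equiv> j \<circ> the_inv \<phi>"
abbreviation "s' \<equiv> s \<circ> the_inv \<psi>"

lemma bij_phi: "bij \<phi>" and bij_psi: "bij \<psi>" and hom_phi: "ly_hom V V \<phi>"
  and hom_psi: "ly_hom L L \<psi>"
  using phi psi by (auto simp: ly_Aut_def)

text \<open>
  Composing \<open>p\<close> with \<open>\<psi>\<close> compensates for the change of \<open>s\<close>, so that \<open>s'\<close> is a section again. The
  image of \<open>V\<close> in \<open>E\<close> does not change.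
\<close>

lemma twist_framed: "framed_extension V E L j' (\<psi> \<circ> p) s'"
proof
  have surj: "surj (the_inv \<phi>)"
    using bij_the_inv[OF bij_phi] by (rule bij_is_surj)
  have range: "range j' = range j"
    using surj by (metis image_comp)
  have zero: "\<psi> x = 0 \<longleftrightarrow> x = 0" for x
  proof -
    interpret psi: Vector_Spaces.linear "smul L" "smul L" \<psi>
      using hom_psi by (simp add: ly_hom_def)
    show ?thesis using psi.zero bij_is_inj[OF bij_psi] by (metis injD)
  qed
  have "inj j'"
    by (intro inj_compose injj bij_is_inj bij_the_inv bij_phi)
  moreover have "surj (\<psi> \<circ> p)"
    using ext by (intro comp_surj[OF _ bij_is_surj[OF bij_psi]]) (simp add: abelian_extension_def)
  moreover have "range j' = {x. (\<psi> \<circ> p) x = 0}"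
    unfolding range rangej using zero by simp
  moreover have "ly_abelian_ideal E (range j')"
    unfolding range by (rule abelian)
  ultimately show "abelian_extension V E L j' (\<psi> \<circ> p)"
    unfolding abelian_extension_def
    by (intro conjI lyV lyE lyL ly_hom_compose[OF ly_hom_the_inv[OF hom_phi bij_phi] homj]
      ly_hom_compose[OF homp hom_psi])
  have "Vector_Spaces.linear (smul L) (smul E) s'"
    using ly_hom_the_inv[OF hom_psi bij_psi] lin_s
    unfolding ly_hom_def by (blast intro: Vector_Spaces.linear_compose)
  then show "is_section E L (\<psi> \<circ> p) s'"
    by (simp add: is_section_def fun_eq_iff p_s bij_inverse bij_psi)
qed

lemma twist_rep:
  "rho (induced_rep E j' s') a v = \<phi> (\<rho> (the_inv \<psi> a) (the_inv \<phi> v))"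
  "repD (induced_rep E j' s') a b v = \<phi> (D (the_inv \<psi> a) (the_inv \<psi> b) (the_inv \<phi> v))"
  "theta (induced_rep E j' s') a b v = \<phi> (\<theta> (the_inv \<psi> a) (the_inv \<psi> b) (the_inv \<phi> v))"
proof -
  interpret Y: framed_extension V E L j' "\<psi> \<circ> p" s' by (rule twist_framed)
  show "Y.\<rho> a v = \<phi> (\<rho> (the_inv \<psi> a) (the_inv \<phi> v))"
    "Y.D a b v = \<phi> (D (the_inv \<psi> a) (the_inv \<psi> b) (the_inv \<phi> v))"
    "Y.\<theta> a b v = \<phi> (\<theta> (the_inv \<psi> a) (the_inv \<psi> b) (the_inv \<phi> v))"
    by (rule injD[OF Y.injj], simp only: Y.j_rho Y.j_D Y.j_theta,
      simp only: o_apply bij_inverse[OF bij_phi] j_rho j_D j_theta)+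
qed

lemma twist_alpha: "ext_alpha E L j' s' a b = \<phi> (\<alpha> (the_inv \<psi> a) (the_inv \<psi> b))"
proof -
  interpret Y: framed_extension V E L j' "\<psi> \<circ> p" s' by (rule twist_framed)
  have "the_inv \<psi> (br L a b) = br L (the_inv \<psi> a) (the_inv \<psi> b)"
    using ly_hom_the_inv[OF hom_psi bij_psi] by (simp add: ly_hom_def)
  then show ?thesis
    by (intro injD[OF Y.injj], simp only: Y.j_alpha)
      (simp only: o_apply bij_inverse[OF bij_phi] j_alpha)
qed

lemma twist_beta:
  "ext_beta E L j' s' a b c = \<phi> (\<beta> (the_inv \<psi> a) (the_inv \<psi> b) (the_inv \<psi> c))"
proof -
  interpret Y: framed_extension V E L j' "\<psi> \<circ> p" s' by (rule twist_framed)
  have "the_inv \<psi> (tr L a b c) = tr L (the_inv \<psi> a) (the_inv \<psi> b) (the_inv \<psi> c)"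
    using ly_hom_the_inv[OF hom_psi bij_psi] by (simp add: ly_hom_def)
  then show ?thesis
    by (intro injD[OF Y.injj], simp only: Y.j_beta)
      (simp only: o_apply bij_inverse[OF bij_phi] j_beta)
qed

text \<open>
  Compatibility of \<open>(\<phi>, \<psi>)\<close> is invariance of the representation under the twist.
\<close>

lemma twist_rep_eq_iff_compatible:
  "induced_rep E j' s' = R \<longleftrightarrow> (\<phi>, \<psi>) \<in> carrier (compatible_pairs V L R)"
proof
  assume eq: "induced_rep E j' s' = R"
  show "(\<phi>, \<psi>) \<in> carrier (compatible_pairs V L R)"
    using phi psi twist_rep(1)[of "\<psi> _" "\<phi> _", symmetric]
      twist_rep(2,3)[of "\<psi> _" "\<psi> _" "\<phi> _", symmetric]
    by (simp add: compatible_pairs_def eq bij_inverse[OF bij_phi] bij_inverse[OF bij_psi])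
next
  assume "(\<phi>, \<psi>) \<in> carrier (compatible_pairs V L R)"
  then show "induced_rep E j' s' = R"
    by (intro ly_rep.equality HOL.ext)
      (simp_all add: twist_rep compatible_pairs_def bij_inverse[OF bij_phi]
        bij_inverse[OF bij_psi])
qed

lemma wells_cochain_eq:
  "wells_cochain E L j s (\<phi>, \<psi>)
    = (\<lambda>a b. ext_alpha E L j' s' a b - \<alpha> a b, \<lambda>a b c. ext_beta E L j' s' a b c - \<beta> a b c)"
  by (simp add: wells_cochain_def twist_alpha twist_beta)

end

section \<open>Compatible pairs and the Wells map\<close>

text \<open>
  The twisted cocycle is the cocycle of an abelian extension with the same representation, so the
  Wells cochain is a difference of two cocycles.
\<close>

lemma wells_cochain_cocycle:
  assumes c: "c \<in> carrier (compatible_pairs V L R)"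
  shows "wells_cochain E L j s c \<in> carrier (Z23 V L R)"
proof -
  obtain \<phi> \<psi> where c_eq: "c = (\<phi>, \<psi>)" by (cases c)
  have phi: "\<phi> \<in> carrier (ly_Aut V)" and psi: "\<psi> \<in> carrier (ly_Aut L)"
    using c by (auto simp: c_eq compatible_pairs_def)
  interpret Y: framed_extension V E L "j' \<phi>" "\<psi> \<circ> p" "s' \<psi>"
    by (rule twist_framed[OF phi psi])
  have "Y.R = R"
    using c twist_rep_eq_iff_compatible[OF phi psi] by (simp add: c_eq)
  then show ?thesis
    using Z23_diff[OF Y.cocycle[unfolded \<open>Y.R = R\<close>] cocycle]
    by (simp only: c_eq wells_cochain_eq[OF phi psi])
qed

lemma wells_map_in: "wells_map V E L j s \<in> carrier (compatible_pairs V L R) \<rightarrow> carrier (H23 V L R)"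
  using wells_cochain_cocycle
  unfolding wells_map_def H23_def FactGroup_def RCOSETS_def by fastforce

lemma wells_map_eq_one_iff:
  assumes c: "c \<in> carrier (compatible_pairs V L R)"
  shows "wells_map V E L j s c = \<one>\<^bsub>H23 V L R\<^esub> \<longleftrightarrow> wells_cochain E L j s c \<in> B23 V L R"
proof -
  interpret normal "B23 V L R" "Z23 V L R" by (rule B23_normal)
  show ?thesis
    using coset_join1[OF _ wells_cochain_cocycle[OF c]] coset_join2[OF wells_cochain_cocycle[OF c]]
      subgroup_axioms
    by (auto simp: wells_map_def H23_def FactGroup_def)
qed

lemma group_compatible_pairs: "group (compatible_pairs V L R)"
proof -
  interpret DP: group "ly_Aut V \<times>\<times> ly_Aut L"
    by (intro DirProd_group group_ly_Aut lyV lyL)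
  have "subgroup (carrier (compatible_pairs V L R)) (ly_Aut V \<times>\<times> ly_Aut L)"
  proof (rule DP.subgroupI)
    show "carrier (compatible_pairs V L R) \<subseteq> carrier (ly_Aut V \<times>\<times> ly_Aut L)"
      by (auto simp: compatible_pairs_def)
    have "\<one>\<^bsub>ly_Aut V \<times>\<times> ly_Aut L\<^esub> \<in> carrier (compatible_pairs V L R)"
      using DP.one_closed by (simp add: compatible_pairs_def) (simp add: ly_Aut_def)
    then show "carrier (compatible_pairs V L R) \<noteq> {}" by blast
  next
    fix c assume c: "c \<in> carrier (compatible_pairs V L R)"
    obtain \<phi> \<psi> where c_eq: "c = (\<phi>, \<psi>)" by (cases c)
    have phi: "\<phi> \<in> carrier (ly_Aut V)" and psi: "\<psi> \<in> carrier (ly_Aut L)"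
      using c by (auto simp: c_eq compatible_pairs_def)
    note bij = bij_inverse[OF bij_phi[OF phi psi]] bij_inverse[OF bij_psi[OF phi psi]]
    have inv: "inv\<^bsub>ly_Aut V \<times>\<times> ly_Aut L\<^esub> c = (the_inv \<phi>, the_inv \<psi>)"
      by (simp add: c_eq phi psi group_ly_Aut lyV lyL inv_ly_Aut)
    have "the_inv \<phi> \<in> carrier (ly_Aut V)" "the_inv \<psi> \<in> carrier (ly_Aut L)"
      using group.inv_closed[OF group_ly_Aut[OF lyV] phi] group.inv_closed[OF group_ly_Aut[OF lyL] psi]
      by (simp_all add: inv_ly_Aut lyV lyL phi psi)
    moreover have "the_inv \<phi> (\<rho> a v) = \<rho> (the_inv \<psi> a) (the_inv \<phi> v)"
      "the_inv \<phi> (D a b v) = D (the_inv \<psi> a) (the_inv \<psi> b) (the_inv \<phi> v)"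
      "the_inv \<phi> (\<theta> a b v) = \<theta> (the_inv \<psi> a) (the_inv \<psi> b) (the_inv \<phi> v)" for a b v
      using c
      by - (rule injD[OF bij_is_inj[OF bij_phi[OF phi psi]]],
        simp add: c_eq compatible_pairs_def bij)+
    ultimately show "inv\<^bsub>ly_Aut V \<times>\<times> ly_Aut L\<^esub> c \<in> carrier (compatible_pairs V L R)"
      by (simp add: inv compatible_pairs_def)
  next
    fix c d
    assume c: "c \<in> carrier (compatible_pairs V L R)" and d: "d \<in> carrier (compatible_pairs V L R)"
    have "c \<otimes>\<^bsub>ly_Aut V \<times>\<times> ly_Aut L\<^esub> d \<in> carrier (ly_Aut V \<times>\<times> ly_Aut L)"
      using c d by (intro DP.m_closed) (auto simp: compatible_pairs_def)
    then show "c \<otimes>\<^bsub>ly_Aut V \<times>\<times> ly_Aut L\<^esub> d \<in> carrier (compatible_pairs V L R)"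
      using c d by (cases c; cases d) (simp add: compatible_pairs_def, simp add: ly_Aut_def)
  qed
  from subgroup.subgroup_is_group[OF this DP.group_axioms]
  show ?thesis by (simp add: compatible_pairs_def)
qed

section \<open>Automorphisms preserving the ideal\<close>

lemma Aut_V_iff:
  "\<gamma> \<in> carrier (Aut_V E j) \<longleftrightarrow> ly_hom E E \<gamma> \<and> bij \<gamma> \<and> \<gamma> ` range j = range j"
  by (simp add: Aut_V_def ly_Aut_def)

lemma group_Aut_V: "group (Aut_V E j)"
proof -
  interpret AE: group "ly_Aut E" by (rule group_ly_Aut[OF lyE])
  have "subgroup (carrier (Aut_V E j)) (ly_Aut E)"
  proof (rule AE.subgroupI)
    have "\<one>\<^bsub>ly_Aut E\<^esub> \<in> carrier (Aut_V E j)"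
      using AE.one_closed by (simp add: Aut_V_iff ly_Aut_def)
    then show "carrier (Aut_V E j) \<noteq> {}" by blast
    show "carrier (Aut_V E j) \<subseteq> carrier (ly_Aut E)"
      by (auto simp: Aut_V_def)
  next
    fix \<gamma> assume \<gamma>: "\<gamma> \<in> carrier (Aut_V E j)"
    then have hom: "ly_hom E E \<gamma>" and bij: "bij \<gamma>" and range: "\<gamma> ` range j = range j"
      unfolding Aut_V_iff by blast+
    have "the_inv \<gamma> ` range j = the_inv \<gamma> ` \<gamma> ` range j"
      by (simp only: range)
    also have "\<dots> = range j"
      by (simp only: image_image bij_inverse(2)[OF bij])
    finally have "the_inv \<gamma> \<in> carrier (Aut_V E j)"
      unfolding Aut_V_iff by (intro conjI ly_hom_the_inv[OF hom bij] bij_the_inv[OF bij])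
    moreover have "\<gamma> \<in> carrier (ly_Aut E)"
      using hom bij by (simp add: ly_Aut_def)
    ultimately show "inv\<^bsub>ly_Aut E\<^esub> \<gamma> \<in> carrier (Aut_V E j)"
      by (simp only: inv_ly_Aut[OF lyE])
  next
    fix \<gamma> \<gamma>' assume "\<gamma> \<in> carrier (Aut_V E j)" "\<gamma>' \<in> carrier (Aut_V E j)"
    then have "ly_hom E E (\<gamma> \<circ> \<gamma>')" "bij (\<gamma> \<circ> \<gamma>')" "(\<gamma> \<circ> \<gamma>') ` range j = range j"
      unfolding Aut_V_iff by (blast intro: ly_hom_compose bij_comp, blast intro: bij_comp,
          metis image_comp)
    then show "\<gamma> \<otimes>\<^bsub>ly_Aut E\<^esub> \<gamma>' \<in> carrier (Aut_V E j)"
      unfolding Aut_V_iff by (simp add: ly_Aut_def)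
  qed
  from subgroup.subgroup_is_group[OF this AE.group_axioms]
  show ?thesis by (simp add: Aut_V_def)
qed

lemma mult_Aut_V: "\<gamma> \<otimes>\<^bsub>Aut_V E j\<^esub> \<gamma>' = \<gamma> \<circ> \<gamma>'"
  by (simp add: Aut_V_def ly_Aut_def)

lemma restrict_eq:
  assumes "\<gamma> \<in> carrier (Aut_V E j)"
  shows "j (aut_restrict j \<gamma> v) = \<gamma> (j v)"
  using assms unfolding aut_restrict_def Aut_V_iff
  by (intro f_the_inv_into_f[OF injj]) blast

text \<open>
  The map induced on \<open>L\<close> may be computed with any lift in place of the section, since \<open>\<gamma>\<close>
  preserves the kernel of \<open>p\<close>. Multiplicativity of \<open>\<gamma> \<mapsto> p \<circ> \<gamma> \<circ> s\<close> and compatibility with the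
  operations of \<open>L\<close> are consequences.
\<close>

lemma bar_eq:
  assumes "\<gamma> \<in> carrier (Aut_V E j)"
  shows "aut_bar p s \<gamma> (p e) = p (\<gamma> e)"
proof (rule emb_cases[of e])
  fix a u assume e: "e = emb a u"
  interpret g: Vector_Spaces.linear "smul E" "smul E" \<gamma>
    using assms by (simp add: Aut_V_iff ly_hom_def)
  interpret p: Vector_Spaces.linear "smul E" "smul L" p by (rule lin_p)
  have "p (\<gamma> (emb a u)) = p (\<gamma> (s a))"
    by (simp add: emb_def g.add p.add restrict_eq[OF assms, symmetric] p_j)
  then show "aut_bar p s \<gamma> (p e) = p (\<gamma> e)"
    by (simp add: e p_emb aut_bar_def)
qed

lemma restrict_eqI: "(\<And>v. \<gamma> (j v) = j (\<phi> v)) \<Longrightarrow> aut_restrict j \<gamma> = \<phi>"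
  by (simp add: aut_restrict_def the_inv_j fun_eq_iff)

lemma restrict_compose:
  assumes "\<gamma> \<in> carrier (Aut_V E j)" "\<gamma>' \<in> carrier (Aut_V E j)"
  shows "aut_restrict j (\<gamma> \<circ> \<gamma>') = aut_restrict j \<gamma> \<circ> aut_restrict j \<gamma>'"
  by (rule restrict_eqI) (simp add: restrict_eq assms)

lemma bar_compose:
  assumes "\<gamma> \<in> carrier (Aut_V E j)" "\<gamma>' \<in> carrier (Aut_V E j)"
  shows "aut_bar p s (\<gamma> \<circ> \<gamma>') = aut_bar p s \<gamma> \<circ> aut_bar p s \<gamma>'"
proof
  fix a
  show "aut_bar p s (\<gamma> \<circ> \<gamma>') a = (aut_bar p s \<gamma> \<circ> aut_bar p s \<gamma>') a"
    using bar_eq[OF assms(1), of "\<gamma>' (s a)"] by (simp add: aut_bar_def)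
qed

lemma restrict_bar_id: "aut_restrict j id = id" "aut_bar p s id = id"
  by (simp_all add: aut_restrict_def aut_bar_def the_inv_j p_s fun_eq_iff)

lemma restrict_bar_Aut:
  assumes \<gamma>: "\<gamma> \<in> carrier (Aut_V E j)"
  shows "aut_restrict j \<gamma> \<in> carrier (ly_Aut V)" "aut_bar p s \<gamma> \<in> carrier (ly_Aut L)"
proof -
  let ?\<phi> = "aut_restrict j \<gamma>" and ?\<psi> = "aut_bar p s \<gamma>"
  interpret AV: group "Aut_V E j" by (rule group_Aut_V)
  define \<gamma>' where "\<gamma>' = inv\<^bsub>Aut_V E j\<^esub> \<gamma>"
  have \<gamma>': "\<gamma>' \<in> carrier (Aut_V E j)" and "\<gamma> \<circ> \<gamma>' = id" "\<gamma>' \<circ> \<gamma> = id"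
    using AV.inv_closed[OF \<gamma>] AV.r_inv[OF \<gamma>] AV.l_inv[OF \<gamma>]
    by (simp_all add: \<gamma>'_def mult_Aut_V) (simp_all add: Aut_V_def ly_Aut_def)
  then have "bij ?\<phi>" "bij ?\<psi>"
    using restrict_compose[OF \<gamma> \<gamma>'] restrict_compose[OF \<gamma>' \<gamma>] bar_compose[OF \<gamma> \<gamma>']
      bar_compose[OF \<gamma>' \<gamma>] restrict_bar_id
    by (metis o_bij)+
  have hom: "ly_hom E E \<gamma>" using \<gamma> by (simp add: Aut_V_iff)
  have "ly_hom V V ?\<phi>"
    unfolding ly_hom_def Vector_Spaces.linear_iff
  proof (intro conjI allI ly_vs[OF lyV])
    fix u v w k
    interpret j: Vector_Spaces.linear "smul V" "smul E" j by (rule lin_j)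
    interpret g: Vector_Spaces.linear "smul E" "smul E" \<gamma>
      using hom by (simp add: ly_hom_def)
    show "?\<phi> (u + v) = ?\<phi> u + ?\<phi> v" "?\<phi> (smul V k v) = smul V k (?\<phi> v)"
      by (rule injD[OF injj], simp add: restrict_eq[OF \<gamma>] j.add j.scale g.add g.scale)+
    show "?\<phi> (br V u v) = br V (?\<phi> u) (?\<phi> v)"
      "?\<phi> (tr V u v w) = tr V (?\<phi> u) (?\<phi> v) (?\<phi> w)"
      using homj hom unfolding ly_hom_def
      by - (rule injD[OF injj], simp add: restrict_eq[OF \<gamma>])+
  qed
  with \<open>bij ?\<phi>\<close> show "?\<phi> \<in> carrier (ly_Aut V)" by (simp add: ly_Aut_def)
  have "ly_hom L L ?\<psi>"
    unfolding ly_hom_def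
  proof (intro conjI allI)
    show "Vector_Spaces.linear (smul L) (smul L) ?\<psi>"
      unfolding aut_bar_def
      using hom lin_s lin_p unfolding ly_hom_def by (blast intro: Vector_Spaces.linear_compose)
    fix a b c
    have p: "br L (p x) (p y) = p (br E x y)" "tr L (p x) (p y) (p z) = p (tr E x y z)" for x y z
      using homp by (simp_all add: ly_hom_def)
    have g: "br E (\<gamma> x) (\<gamma> y) = \<gamma> (br E x y)" "tr E (\<gamma> x) (\<gamma> y) (\<gamma> z) = \<gamma> (tr E x y z)" for x y z
      using hom by (simp_all add: ly_hom_def)
    have "?\<psi> (br L (p (s a)) (p (s b))) = br L (?\<psi> (p (s a))) (?\<psi> (p (s b)))"
      "?\<psi> (tr L (p (s a)) (p (s b)) (p (s c)))
        = tr L (?\<psi> (p (s a))) (?\<psi> (p (s b))) (?\<psi> (p (s c)))"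
      by (simp_all only: p bar_eq[OF \<gamma>] g)
    then show "?\<psi> (br L a b) = br L (?\<psi> a) (?\<psi> b)"
      "?\<psi> (tr L a b c) = tr L (?\<psi> a) (?\<psi> b) (?\<psi> c)"
      by (simp_all only: p_s)
  qed
  with \<open>bij ?\<psi>\<close> show "?\<psi> \<in> carrier (ly_Aut L)" by (simp add: ly_Aut_def)
qed

text \<open>
  If \<open>\<gamma>\<close> induces \<open>(\<phi>, \<psi>)\<close>, it maps the twisted frame \<open>(j \<circ> \<phi>\<inverse>, s \<circ> \<psi>\<inverse>)\<close> to
  \<open>(j, s + j \<circ> l)\<close>: it agrees with \<open>\<phi>\<close> on \<open>V\<close>, and \<open>\<gamma> \<circ> s \<circ> \<psi>\<inverse>\<close> is again a section of \<open>p\<close>. Hence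
  both frames carry the same data, which gives compatibility of \<open>(\<phi>, \<psi>)\<close>, the vanishing of the
  Wells class, and for \<open>\<phi> = id\<close> and \<open>\<psi> = id\<close> the condition \<open>\<delta> l = 0\<close>.
\<close>

lemma Aut_V_twist_data:
  assumes \<gamma>: "\<gamma> \<in> carrier (Aut_V E j)"
  defines "\<phi> \<equiv> aut_restrict j \<gamma>" and "\<psi> \<equiv> aut_bar p s \<gamma>"
  defines "l \<equiv> \<lambda>a. the_inv j (\<gamma> (s (the_inv \<psi> a)) - s a)"
  shows "Vector_Spaces.linear (smul L) (smul V) l"
    and "induced_rep E (j \<circ> the_inv \<phi>) (s \<circ> the_inv \<psi>) = R"
    and "ext_alpha E L (j \<circ> the_inv \<phi>) (s \<circ> the_inv \<psi>) a b = \<alpha> a b + delta1_I L R l a b"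
    and "ext_beta E L (j \<circ> the_inv \<phi>) (s \<circ> the_inv \<psi>) a b c = \<beta> a b c + delta1_II L R l a b c"
    and "\<gamma> (s (the_inv \<psi> a)) = emb a (l a)"
proof -
  have phi: "\<phi> \<in> carrier (ly_Aut V)" and psi: "\<psi> \<in> carrier (ly_Aut L)"
    using restrict_bar_Aut[OF \<gamma>] by (simp_all add: \<phi>_def \<psi>_def)
  have bij: "bij \<phi>" "bij \<psi>" using phi psi by (simp_all add: ly_Aut_def)
  have hom: "ly_hom E E \<gamma>" using \<gamma> by (simp add: Aut_V_iff)
  interpret p: Vector_Spaces.linear "smul E" "smul L" p by (rule lin_p)
  interpret j: Vector_Spaces.linear "smul V" "smul E" j by (rule lin_j)
  interpret s: Vector_Spaces.linear "smul L" "smul E" s by (rule lin_s)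
  interpret g: Vector_Spaces.linear "smul E" "smul E" \<gamma>
    using hom by (simp add: ly_hom_def)
  interpret i: Vector_Spaces.linear "smul L" "smul L" "the_inv \<psi>"
    using ly_hom_the_inv[of L L \<psi>] psi by (simp add: ly_Aut_def ly_hom_def)
  have j_l: "j (l a) = \<gamma> (s (the_inv \<psi> a)) - s a" for a
    using bar_eq[OF \<gamma>, of "s (the_inv \<psi> a)"] bij_inverse(1)[OF bij(2), of a]
    by (auto simp: l_def \<psi>_def[symmetric] p_s p.diff intro!: j_the_inv)
  show lin: "Vector_Spaces.linear (smul L) (smul V) l"
    unfolding Vector_Spaces.linear_iff
    by (intro conjI allI ly_vs[OF lyV] ly_vs[OF lyL]; rule injD[OF injj])
      (simp_all add: j_l j.add j.scale s.add s.scale g.add g.scale i.add i.scale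
        p.vs1.scale_right_diff_distrib)
  show g_s: "\<gamma> (s (the_inv \<psi> a)) = emb a (l a)" for a
    by (simp add: emb_def j_l)
  have g_j: "\<gamma> (j (the_inv \<phi> v)) = j v" for v
    using restrict_eq[OF \<gamma>, of "the_inv \<phi> v"] bij_inverse(1)[OF bij(1), of v]
    by (simp add: \<phi>_def)
  note transport = induced_data_transport[OF twist_framed[OF phi psi] change_section_framed[OF lin] hom,
      unfolded o_apply, OF g_j g_s, symmetric]
  show "induced_rep E (j \<circ> the_inv \<phi>) (s \<circ> the_inv \<psi>) = R"
    using transport(1) change_section_rep[OF lin] by (simp add: o_def)
  show "ext_alpha E L (j \<circ> the_inv \<phi>) (s \<circ> the_inv \<psi>) a b = \<alpha> a b + delta1_I L R l a b"
    using transport(2) change_section_alpha[OF lin] by (simp add: o_def)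
  show "ext_beta E L (j \<circ> the_inv \<phi>) (s \<circ> the_inv \<psi>) a b c = \<beta> a b c + delta1_II L R l a b c"
    using transport(3) change_section_beta[OF lin] by (simp add: o_def)
qed

lemma tau_compatible:
  assumes \<gamma>: "\<gamma> \<in> carrier (Aut_V E j)"
  shows "tau_map j p s \<gamma> \<in> carrier (compatible_pairs V L R)"
  using twist_rep_eq_iff_compatible[OF restrict_bar_Aut[OF \<gamma>]] Aut_V_twist_data(2)[OF \<gamma>]
  by (simp add: tau_map_def)

lemma tau_hom: "tau_map j p s \<in> hom (Aut_V E j) (compatible_pairs V L R)"
proof (rule homI)
  fix \<gamma> \<gamma>' assume "\<gamma> \<in> carrier (Aut_V E j)" "\<gamma>' \<in> carrier (Aut_V E j)"
  then have "tau_map j p s (\<gamma> \<otimes>\<^bsub>Aut_V E j\<^esub> \<gamma>')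
      = (aut_restrict j \<gamma> \<circ> aut_restrict j \<gamma>', aut_bar p s \<gamma> \<circ> aut_bar p s \<gamma>')"
    by (simp add: mult_Aut_V tau_map_def restrict_compose bar_compose)
  also have "\<dots> = tau_map j p s \<gamma> \<otimes>\<^bsub>compatible_pairs V L R\<^esub> tau_map j p s \<gamma>'"
    by (simp add: tau_map_def compatible_pairs_def DirProd_def ly_Aut_def)
  finally show "tau_map j p s (\<gamma> \<otimes>\<^bsub>Aut_V E j\<^esub> \<gamma>')
      = tau_map j p s \<gamma> \<otimes>\<^bsub>compatible_pairs V L R\<^esub> tau_map j p s \<gamma>'" .
qed (rule tau_compatible)

section \<open>Exactness at the compatible pairs\<close>

lemma tau_image:
  "tau_map j p s ` carrier (Aut_V E j)
    = {c \<in> carrier (compatible_pairs V L R). wells_map V E L j s c = \<one>\<^bsub>H23 V L R\<^esub>}"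
proof (intro equalityI subsetI)
  fix c assume "c \<in> tau_map j p s ` carrier (Aut_V E j)"
  then obtain \<gamma> where \<gamma>: "\<gamma> \<in> carrier (Aut_V E j)" and c: "c = tau_map j p s \<gamma>" by blast
  have mem: "c \<in> carrier (compatible_pairs V L R)" using tau_compatible[OF \<gamma>] c by simp
  have "wells_cochain E L j s c \<in> B23 V L R"
    using Aut_V_twist_data(1)[OF \<gamma>]
    by (auto simp: c tau_map_def wells_cochain_eq[OF restrict_bar_Aut[OF \<gamma>]] B23_def
        Aut_V_twist_data(3,4)[OF \<gamma>])
  with mem show "c \<in> {c \<in> carrier (compatible_pairs V L R). wells_map V E L j s c = \<one>\<^bsub>H23 V L R\<^esub>}"
    by (simp add: wells_map_eq_one_iff)
next
  fix c assume "c \<in> {c \<in> carrier (compatible_pairs V L R). wells_map V E L j s c = \<one>\<^bsub>H23 V L R\<^esub>}"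
  then have mem: "c \<in> carrier (compatible_pairs V L R)"
    and "wells_map V E L j s c = \<one>\<^bsub>H23 V L R\<^esub>"
    by simp_all
  then have "wells_cochain E L j s c \<in> B23 V L R"
    using wells_map_eq_one_iff by blast
  then obtain l where l: "Vector_Spaces.linear (smul L) (smul V) l"
    and w: "wells_cochain E L j s c = (delta1_I L R l, delta1_II L R l)"
    by (auto simp: B23_def)
  obtain \<phi> \<psi> where c_eq: "c = (\<phi>, \<psi>)" by (cases c)
  have phi: "\<phi> \<in> carrier (ly_Aut V)" and psi: "\<psi> \<in> carrier (ly_Aut L)"
    using mem by (auto simp: c_eq compatible_pairs_def)
  have bij: "bij \<phi>" "bij \<psi>" using phi psi by (simp_all add: ly_Aut_def)
  have rep: "induced_rep E (j \<circ> the_inv \<phi>) (s \<circ> the_inv \<psi>) = R"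
    using mem twist_rep_eq_iff_compatible[OF phi psi] by (simp add: c_eq)
  have diff: "ext_alpha E L (j \<circ> the_inv \<phi>) (s \<circ> the_inv \<psi>) a b - \<alpha> a b = delta1_I L R l a b"
    "ext_beta E L (j \<circ> the_inv \<phi>) (s \<circ> the_inv \<psi>) a b d - \<beta> a b d = delta1_II L R l a b d" for a b d
    using w by (simp_all add: c_eq wells_cochain_eq[OF phi psi] fun_eq_iff)
  \<comment> \<open>By the choice of \<open>l\<close>, the twisted frame and \<open>(j, s + j \<circ> l)\<close> carry the same data.\<close>
  obtain \<gamma> where hom: "ly_hom E E \<gamma>" and "bij \<gamma>"
    and g_j: "\<And>v. \<gamma> ((j \<circ> the_inv \<phi>) v) = j v"
    and g_s: "\<And>a. \<gamma> ((s \<circ> the_inv \<psi>) a) = emb a (l a)"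
  proof (rule equivalent_extensions[OF twist_framed[OF phi psi] change_section_framed[OF l]])
    show "induced_rep E (j \<circ> the_inv \<phi>) (s \<circ> the_inv \<psi>) = induced_rep E j (\<lambda>a. emb a (l a))"
      using rep change_section_rep[OF l] by simp
    show "ext_alpha E L (j \<circ> the_inv \<phi>) (s \<circ> the_inv \<psi>) = ext_alpha E L j (\<lambda>a. emb a (l a))"
      by (intro HOL.ext) (simp add: change_section_alpha[OF l] diff[symmetric])
    show "ext_beta E L (j \<circ> the_inv \<phi>) (s \<circ> the_inv \<psi>) = ext_beta E L j (\<lambda>a. emb a (l a))"
      by (intro HOL.ext) (simp add: change_section_beta[OF l] diff[symmetric])
  qed (use that in blast)
  have g_j': "\<gamma> (j v) = j (\<phi> v)" for v
    using g_j[of "\<phi> v"] by (simp add: bij_inverse[OF bij(1)])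
  have "\<gamma> ` range j = j ` range \<phi>"
    by (auto simp: g_j' image_image)
  then have "\<gamma> ` range j = range j"
    using bij_is_surj[OF bij(1)] by simp
  then have \<gamma>: "\<gamma> \<in> carrier (Aut_V E j)"
    using hom \<open>bij \<gamma>\<close> by (simp add: Aut_V_iff)
  have "aut_bar p s \<gamma> = \<psi>"
    using g_s[of "\<psi> _"] by (simp add: aut_bar_def fun_eq_iff bij_inverse[OF bij(2)] p_emb)
  then have "tau_map j p s \<gamma> = c"
    using restrict_eqI[of \<gamma> \<phi>, OF g_j'] by (simp add: tau_map_def c_eq)
  then show "c \<in> tau_map j p s ` carrier (Aut_V E j)" using \<gamma> by blast
qed

section \<open>Exactness at the automorphism group\<close>

lemma Aut_VL_iff:
  "\<gamma> \<in> carrier (Aut_VL E j p s)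
    \<longleftrightarrow> \<gamma> \<in> carrier (Aut_V E j) \<and> aut_restrict j \<gamma> = id \<and> aut_bar p s \<gamma> = id"
  by (simp add: Aut_VL_def)

lemma kernel_tau:
  "kernel (Aut_V E j) (compatible_pairs V L R) (tau_map j p s) = carrier (Aut_VL E j p s)"
proof -
  have "\<one>\<^bsub>compatible_pairs V L R\<^esub> = (id, id)"
    by (simp add: compatible_pairs_def) (simp add: ly_Aut_def)
  then show ?thesis
    by (auto simp: kernel_def Aut_VL_iff tau_map_def)
qed

lemma group_Aut_VL: "group (Aut_VL E j p s)"
proof -
  have "group_hom (Aut_V E j) (compatible_pairs V L R) (tau_map j p s)"
    using group_Aut_V group_compatible_pairs tau_hom
    by (simp add: group_hom_def group_hom_axioms_def)
  from subgroup.subgroup_is_group[OF group_hom.subgroup_kernel[OF this] group_Aut_V]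
  show ?thesis unfolding kernel_tau by (simp add: Aut_VL_def Aut_V_def)
qed

text \<open>
  Automorphisms inducing the identity on \<open>V\<close> and \<open>L\<close> are shears in the coordinates. This makes
  \<open>lambda_map\<close> additive and injective.
\<close>

lemma Aut_VL_emb:
  assumes \<gamma>: "\<gamma> \<in> carrier (Aut_VL E j p s)"
  shows "\<gamma> (emb a u) = emb a (lambda_map j s \<gamma> a + u)"
    and "lambda_map j s \<gamma> \<in> carrier (H1 V L R)"
proof -
  have \<gamma>V: "\<gamma> \<in> carrier (Aut_V E j)" and [simp]: "aut_restrict j \<gamma> = id" "aut_bar p s \<gamma> = id"
    using \<gamma> by (simp_all add: Aut_VL_iff)
  interpret g: Vector_Spaces.linear "smul E" "smul E" \<gamma>
    using \<gamma>V by (simp add: Aut_V_iff ly_hom_def)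
  have inv_id: "the_inv (id :: 'l \<Rightarrow> 'l) x = x" "the_inv (id :: 'v \<Rightarrow> 'v) v = v" for x v
    by (simp_all add: bij_inverse(2)[of id, simplified])
  note facts = Aut_V_twist_data[OF \<gamma>V, unfolded \<open>aut_restrict j \<gamma> = id\<close> \<open>aut_bar p s \<gamma> = id\<close>
      inv_id, folded lambda_map_def]
  show "lambda_map j s \<gamma> \<in> carrier (H1 V L R)"
    using facts(1,3,4) by (simp add: H1_def o_def)
  show "\<gamma> (emb a u) = emb a (lambda_map j s \<gamma> a + u)"
  proof -
    have "\<gamma> (s a) = emb a (lambda_map j s \<gamma> a)"
      using facts(5)[of a] unfolding lambda_map_def .
    moreover have "\<gamma> (j u) = j u"
      using restrict_eq[OF \<gamma>V, of u] by simp
    ultimately show ?thesis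
      by (simp only: emb_def[of a u] g.add) (simp add: j_eq_emb emb_add)
  qed
qed

lemma lambda_eqI: "(\<And>a. \<gamma> (s a) = emb a (l a)) \<Longrightarrow> lambda_map j s \<gamma> = l"
  by (simp add: lambda_map_def fun_eq_iff emb_def the_inv_j)

text \<open>
  Surjectivity: if \<open>\<delta> l = 0\<close>, the frames \<open>(j, s)\<close> and \<open>(j, s + j \<circ> l)\<close> have the same data, and the
  isomorphism between them is the required automorphism.
\<close>

lemma lambda_iso: "lambda_map j s \<in> iso (Aut_VL E j p s) (H1 V L R)"
proof (rule isoI)
  let ?G = "carrier (Aut_VL E j p s)"
  show "lambda_map j s \<in> hom (Aut_VL E j p s) (H1 V L R)"
  proof (rule homI)
    fix \<gamma> \<gamma>' assume \<gamma>: "\<gamma> \<in> ?G" and \<gamma>': "\<gamma>' \<in> ?G"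
    have "lambda_map j s (\<gamma> \<circ> \<gamma>') = (\<lambda>a. lambda_map j s \<gamma> a + lambda_map j s \<gamma>' a)"
      by (rule lambda_eqI) (simp add: s_eq_emb Aut_VL_emb(1)[OF \<gamma>] Aut_VL_emb(1)[OF \<gamma>'])
    then show "lambda_map j s (\<gamma> \<otimes>\<^bsub>Aut_VL E j p s\<^esub> \<gamma>')
        = lambda_map j s \<gamma> \<otimes>\<^bsub>H1 V L R\<^esub> lambda_map j s \<gamma>'"
      by (simp add: Aut_VL_def ly_Aut_def H1_def)
  qed (rule Aut_VL_emb(2))
  have "inj_on (lambda_map j s) ?G"
  proof (rule inj_onI)
    fix \<gamma> \<gamma>' assume \<gamma>: "\<gamma> \<in> ?G" and \<gamma>': "\<gamma>' \<in> ?G" and eq: "lambda_map j s \<gamma> = lambda_map j s \<gamma>'"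
    show "\<gamma> = \<gamma>'"
    proof
      fix e
      show "\<gamma> e = \<gamma>' e"
        by (rule emb_cases[of e]) (simp add: Aut_VL_emb(1)[OF \<gamma>] Aut_VL_emb(1)[OF \<gamma>'] eq)
    qed
  qed
  moreover have "lambda_map j s ` ?G = carrier (H1 V L R)"
  proof (intro equalityI subsetI)
    fix l assume "l \<in> carrier (H1 V L R)"
    then have l: "Vector_Spaces.linear (smul L) (smul V) l"
      and zero: "\<And>a b. delta1_I L R l a b = 0" "\<And>a b c. delta1_II L R l a b c = 0"
      by (simp_all add: H1_def)
    obtain \<gamma> where "ly_hom E E \<gamma>" "bij \<gamma>" and g_j: "\<And>v. \<gamma> (j v) = j v"
      and g_s: "\<And>a. \<gamma> (s a) = emb a (l a)"
    proof (rule equivalent_extensions[OF framed_extension_axioms change_section_framed[OF l]])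
      show "R = induced_rep E j (\<lambda>a. emb a (l a))"
        using change_section_rep[OF l] by simp
      show "\<alpha> = ext_alpha E L j (\<lambda>a. emb a (l a))" "\<beta> = ext_beta E L j (\<lambda>a. emb a (l a))"
        by (simp_all add: fun_eq_iff change_section_alpha[OF l] change_section_beta[OF l] zero)
    qed (use that in blast)
    moreover have "\<gamma> ` range j = range j" by (simp add: image_image g_j)
    moreover have "aut_restrict j \<gamma> = id" by (rule restrict_eqI) (simp add: g_j)
    moreover have "aut_bar p s \<gamma> = id" by (simp add: aut_bar_def fun_eq_iff g_s p_emb)
    ultimately have "\<gamma> \<in> ?G" by (simp add: Aut_VL_iff Aut_V_iff)
    then show "l \<in> lambda_map j s ` ?G"
      using lambda_eqI[of \<gamma> l, OF g_s] by blast
  qed (auto simp: Aut_VL_emb(2))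
  ultimately show "bij_betw (lambda_map j s) ?G (carrier (H1 V L R))"
    by (simp add: bij_betw_def)
qed

lemma i_iso: "i_map E j p s \<in> iso (H1 V L R) (Aut_VL E j p s)"
  unfolding i_map_def by (rule group.iso_set_sym[OF group_Aut_VL lambda_iso])

lemma i_hom: "i_map E j p s \<in> hom (H1 V L R) (Aut_V E j)"
  and i_inj: "inj_on (i_map E j p s) (carrier (H1 V L R))"
  and i_image: "i_map E j p s ` carrier (H1 V L R) = carrier (Aut_VL E j p s)"
proof -
  have hom: "i_map E j p s \<in> hom (H1 V L R) (Aut_VL E j p s)"
    and bij: "bij_betw (i_map E j p s) (carrier (H1 V L R)) (carrier (Aut_VL E j p s))"
    using i_iso by (simp_all add: iso_def)
  have "mult (Aut_VL E j p s) = mult (Aut_V E j)"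
    by (simp add: Aut_VL_def Aut_V_def)
  then show "i_map E j p s \<in> hom (H1 V L R) (Aut_V E j)"
    using hom by (auto simp: hom_def Pi_iff Aut_VL_iff)
  show "inj_on (i_map E j p s) (carrier (H1 V L R))"
    and "i_map E j p s ` carrier (H1 V L R) = carrier (Aut_VL E j p s)"
    using bij by (simp_all add: bij_betw_def)
qed

end

section \<open>The Wells exact sequence\<close>

theorem theorem5p3:
  fixes V :: "('k::field_char_0, 'v::ab_group_add) ly_struct"
    and E :: "('k, 'e::ab_group_add) ly_struct"
    and L :: "('k, 'l::ab_group_add) ly_struct"
    and j :: "'v \<Rightarrow> 'e" and p :: "'e \<Rightarrow> 'l" and s :: "'l \<Rightarrow> 'e"
    and R :: "('l, 'v) ly_rep"
  assumes ext: "abelian_extension V E L j p"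
    and sec: "is_section E L p s"
    and R: "R = induced_rep E j s"
  shows "group (H1 V L R) \<and> group (Aut_V E j) \<and> group (compatible_pairs V L R)
    \<and> B23 V L R \<lhd> Z23 V L R \<and> group (H23 V L R)
    \<and> lambda_map j s \<in> iso (Aut_VL E j p s) (H1 V L R)
    \<and> i_map E j p s \<in> hom (H1 V L R) (Aut_V E j)
    \<and> tau_map j p s \<in> hom (Aut_V E j) (compatible_pairs V L R)
    \<and> wells_map V E L j s \<in> carrier (compatible_pairs V L R) \<rightarrow> carrier (H23 V L R)
    \<and> inj_on (i_map E j p s) (carrier (H1 V L R))
    \<and> i_map E j p s ` carrier (H1 V L R)
        = kernel (Aut_V E j) (compatible_pairs V L R) (tau_map j p s)
    \<and> tau_map j p s ` carrier (Aut_V E j)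
        = {c \<in> carrier (compatible_pairs V L R). wells_map V E L j s c = \<one>\<^bsub>H23 V L R\<^esub>}"
proof -
  interpret X: framed_extension V E L j p s
    using ext sec by (rule framed_extension.intro)
  show ?thesis
    unfolding R X.kernel_tau
    using normal.factorgroup_is_group[OF X.B23_normal, folded H23_def]
    by (intro conjI X.group_H1 X.group_Aut_V X.group_compatible_pairs X.B23_normal X.lambda_iso
        X.i_hom X.tau_hom X.wells_map_in X.i_inj X.i_image X.tau_image)
qed

end
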